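(* Suppose that $f$ is coercive, i.e. $\liminf_{\|x\|\to\infty} f(x)/\|x\|=\infty$, and let $\{(\bar x^j,\bar w^j)\}_{j\in\mathbb N}$ be the sequence generated by the semismooth Newton algorithm SNA applied to the problems $(P_k)$ and $(D_k)$ described in the context. Then for sufficiently large $j$, the pair $(x^{k+1},w^{k+1})=(\bar x^j,\bar w^j)$ satisfies all three of the following criteria: $$\text{(C1)}\quad \Xi_k(w^{k+1})-\Xi_k(\tilde w^k)\le\frac1{4\gamma_k}\|w^{k+1}-w^k\|_M^2,$$ $$\text{(C2)}\quad G_k(x^{k+1},w^{k+1})\le\frac{\varepsilon_k^2}{2\gamma_k},\qquad 0\le\varepsilon_k,\quad \sum_{k=0}^\infty\varepsilon_k<\infty,$$ $$\text{(C3)}\quad G_k(x^{k+1},w^{k+1})\le\frac{\eta_k^2}{2\gamma_k}\|w^{k+1}-w^k\|_M^2,\qquad 0\le\eta_k<1,\quad \sum_{k=0}^\infty\eta_k<\infty .$$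
   Context: **Data.** $f:\mathbb R^n\to(-\infty,\infty]$ and $g:\mathbb R^m\to(-\infty,\infty]$ are proper, closed, convex; $A:\mathbb R^n\to\mathbb R^m$ and $B:\mathbb R^n\to\mathbb R^p$ are linear (identified with matrices); $Qx:=[Ax;Bx]\in\mathbb R^{m+p}$; $M:=QQ^\top+I$; $\|w\|_M^2:=\langle w,Mw\rangle$. Vectors of $\mathbb R^{m+p}$ are written $w=[y;z]$ with $y\in\mathbb R^m$, $z\in\mathbb R^p$. $f^*,g^*$ are the Fenchel conjugates. $\mu\in\mathbb R^p$ has positive entries. For $T\subseteq[p]=\{1,\dots,p\}$, $\overline T=[p]\setminus T$, $z_T$ is the subvector of $z$ indexed by $T$, $B_{T:}$ the submatrix of rows indexed by $T$. For $\sigma>0$ and $\psi$ proper closed convex, $\mathcal E_{\sigma\psi}(p)=\min_x\{\frac1{2\sigma}\|x-p\|^2+\psi(x)\}$ and $\mathrm{Prox}_{\sigma\psi}(p)$ is the unique minimizer. **Subproblems.** Let $x^k\in\mathbb R^n$ and $w^k=[y^k;z^k]\in\mathbb R^{m+p}$ be the $k$-th primal and dual iterates of the outer proximal point algorithm for $\min_{w=[y;z]}\Xi(w)+\sum_{i=1}^p\mu_i\mathbb 1_{\{z_i\neq0\}}$, where $\Xi(w)=f^*(-Q^\top w)+g^*(y)$; let $\gamma_k>0$ and $$\Xi_k(w)=\Xi(w)+\tfrac1{2\gamma_k}\|w-w^k\|_M^2 .$$ The point $\tilde z^k\in\mathbb R^p$ is obtained by one cycle of coordinate minimization: successively for $i=1,\dots,p$,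 $\tilde z_i^k\in\operatorname{argmin}_{t\in\mathbb R}\ \Xi_k(y^k,\tilde z^k_1,\dots,\tilde z^k_{i-1},t,z^k_{i+1},\dots,z^k_p)+\mu_i\mathbb 1_{\{t\ne0\}}$. Put $\tilde w^k=[y^k;\tilde z^k]$ and $T_k=\{i\in[p]:\tilde z^k_i\ne0\}$. $(D_k)$ is the problem of minimizing $\Xi_k(w)$ over $w=[y;z]$ subject to $z_{\overline T_k}=0$. $(P_k)$ is the problem of minimizing over $x\in\mathbb R^n$ $$\Psi_k(x)=f_k(x)+g_k(Ax)+h_k(Bx),$$ where $f_k(x)=\mathcal E_{\frac1{\gamma_k}f}(x-Q^\top w^k/\gamma_k)-\frac1{2\gamma_k}\|Q^\top w^k\|^2$, $g_k(u)=\mathcal E_{\frac1{\gamma_k}g}(u+y^k/\gamma_k)-\frac1{2\gamma_k}\|y^k\|^2$, $h_k(v)=\frac{\gamma_k}2\|(v+z^k/\gamma_k)_{T_k}\|^2-\frac1{2\gamma_k}\|z^k\|^2$. These are convex with $\gamma_k$-Lipschitz gradients. The duality gap is $G_k(x,w)=\Psi_k(x)+\Xi_k(w)$. The numbers $\varepsilon_k$ and $\eta_k$ are the $k$-th terms of tolerance sequences prescribed for the outer algorithm, with the ranges and summability stated in (C2) and (C3). **Generalized Hessian.** $\widehat\partial^2\Psi_k(x)=\partial^2f_k(x)+A^\top\partial^2g_k(Ax)A+\gamma_kB_{T_k:}^\top B_{T_k:}$ (a set of matrices), where $\partial^2 f_k,\partial^2 g_k$ are the Clarke generalized Jacobians of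 $\nabla f_k,\nabla g_k$. **Algorithm SNA.** Parameters $\tau\in(0,1]$, $\tau_1,\tau_2,\beta\in(0,1)$, $\zeta\in(0,1/2)$; starting point $(\bar x^0,\bar w^0)=(x^k,\tilde w^k)$. For $j=0,1,\dots$: 1. Newton direction: compute $H_j\in\widehat\partial^2\Psi_k(\bar x^j)$ and $\theta_j=\tau_1\|\nabla\Psi_k(\bar x^j)\|$. Apply the conjugate gradient method to find an approximate solution $d^j$ to $(H_j+\theta_jI)d=-\nabla\Psi_k(\bar x^j)$ such that $\|(H_j+\theta_jI)d^j+\nabla\Psi_k(\bar x^j)\|\le\tau_2\|\nabla\Psi_k(\bar x^j)\|^{1+\tau}$. 2. Line search: set $\alpha_j=\beta^{q_j}$ with $q_j$ the smallest nonnegative integer $q$ such that $\Psi_k(\bar x^j+\beta^qd^j)\le\Psi_k(\bar x^j)+\zeta\beta^q\langle\nabla\Psi_k(\bar x^j),d^j\rangle$; set $\bar x^{j+1}=\bar x^j+\alpha_jd^j$. 3. Dual recovery: update $\bar w^j=[\bar y^j;\bar z^j]$ by $\bar y^j=\mathrm{Prox}_{\gamma_kg^*}(\gamma_kA\bar x^j+y^k)$, $\bar z^j_{T_k}=z^k_{T_k}+\gamma_kB_{T_k:}\bar x^j$, $\bar z^j_{\overline T_k}=0$. The theorem concerns the infinite sequence indexed by $j\in\mathbb N$, i.e. the algorithm without its stopping test.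
   Formalization: Assumes in addition that ε_k > 0, η_k > 0 and that w^k does not already solve (D_k), without which the criteria can fail for every j; the conjugate gradient method is started at zero and makes at least one step. *)

theory Defs
  imports "HOL-Analysis.Analysis"
begin

section \<open>Convex analysis\<close>

text \<open>Closedness and convexity of an extended-real function are those of its epigraph.\<close>

definition epi :: "('a \<Rightarrow> ereal) \<Rightarrow> ('a \<times> real) set" where
  "epi \<psi> = {(x, r). \<psi> x \<le> ereal r}"

definition proper_closed_convex :: "('a::euclidean_space \<Rightarrow> ereal) \<Rightarrow> bool" where
  "proper_closed_convex \<psi> \<longleftrightarrow>
     (\<forall>x. \<psi> x \<noteq> -\<infinity>) \<and> (\<exists>x. \<psi> x \<noteq> \<infinity>) \<and> closed (epi \<psi>) \<and> convex (epi \<psi>)"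

definition coercive :: "('a::euclidean_space \<Rightarrow> ereal) \<Rightarrow> bool" where
  "coercive \<psi> \<longleftrightarrow> Liminf at_infinity (\<lambda>x. \<psi> x / ereal (norm x)) = \<infinity>"

definition fenchel_conj :: "('a::euclidean_space \<Rightarrow> ereal) \<Rightarrow> 'a \<Rightarrow> ereal" where
  "fenchel_conj \<psi> s = (SUP x. ereal (s \<bullet> x) - \<psi> x)"

definition prox_obj :: "real \<Rightarrow> ('a::euclidean_space \<Rightarrow> ereal) \<Rightarrow> 'a \<Rightarrow> 'a \<Rightarrow> ereal" where
  "prox_obj \<sigma> \<psi> p x = ereal (1 / (2 * \<sigma>) * (norm (x - p))\<^sup>2) + \<psi> x"

text \<open>For \<open>\<sigma> > 0\<close> and \<open>\<psi>\<close> proper, closed and convex, the infimum is finite and attained, so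
  that \<open>real_of_ereal\<close> loses nothing, and the minimizer is unique.\<close>

definition moreau_env :: "real \<Rightarrow> ('a::euclidean_space \<Rightarrow> ereal) \<Rightarrow> 'a \<Rightarrow> real" where
  "moreau_env \<sigma> \<psi> p = real_of_ereal (INF x. prox_obj \<sigma> \<psi> p x)"

definition prox :: "real \<Rightarrow> ('a::euclidean_space \<Rightarrow> ereal) \<Rightarrow> 'a \<Rightarrow> 'a" where
  "prox \<sigma> \<psi> p = (THE x. is_arg_min (prox_obj \<sigma> \<psi> p) (\<lambda>_. True) x)"

definition nabla :: "('a::euclidean_space \<Rightarrow> real) \<Rightarrow> 'a \<Rightarrow> 'a" where
  "nabla \<phi> x = (THE D. GDERIV \<phi> x :> D)"

text \<open>Clarke's generalized Jacobian: the convex hull of all limits of Jacobians along sequences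
  of points of differentiability.\<close>

definition clarke_jacobian :: "(real^'a \<Rightarrow> real^'b) \<Rightarrow> real^'a \<Rightarrow> (real^'a^'b) set" where
  "clarke_jacobian F x = convex hull
     {V. \<exists>u. (\<forall>i::nat. F differentiable (at (u i))) \<and> u \<longlonglongrightarrow> x \<and>
             (\<lambda>i. jacobian F (at (u i))) \<longlonglongrightarrow> V}"


section \<open>Dual problem\<close>

text \<open>The vector \<open>w = [y; z]\<close> is the pair \<open>(y, z)\<close>; the product type carries the Euclidean
  inner product.\<close>

type_synonym ('m, 'p) dual = "(real^'m) \<times> (real^'p)"

definition Qmap :: "real^'n^'m \<Rightarrow> real^'n^'p \<Rightarrow> real^'n \<Rightarrow> ('m, 'p) dual" where
  "Qmap A B x = (A *v x, B *v x)"

definition Mmap ::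
  "real^'n^'m \<Rightarrow> real^'n^'p \<Rightarrow> ('m, 'p) dual \<Rightarrow> ('m, 'p) dual" where
  "Mmap A B w = Qmap A B (adjoint (Qmap A B) w) + w"

definition sqnorm_M :: "real^'n^'m \<Rightarrow> real^'n^'p \<Rightarrow> ('m, 'p) dual \<Rightarrow> real" where
  "sqnorm_M A B w = w \<bullet> Mmap A B w"

definition Xi ::
  "(real^'n \<Rightarrow> ereal) \<Rightarrow> (real^'m \<Rightarrow> ereal) \<Rightarrow> real^'n^'m \<Rightarrow> real^'n^'p \<Rightarrow>
   ('m, 'p) dual \<Rightarrow> ereal" where
  "Xi f g A B w =
     fenchel_conj f (- adjoint (Qmap A B) w) + fenchel_conj g (fst w)"

definition Xi_k ::
  "(real^'n \<Rightarrow> ereal) \<Rightarrow> (real^'m \<Rightarrow> ereal) \<Rightarrow> real^'n^'m \<Rightarrow> real^'n^'p \<Rightarrow>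
   real \<Rightarrow> ('m, 'p) dual \<Rightarrow> ('m, 'p) dual \<Rightarrow> ereal" where
  "Xi_k f g A B \<gamma> wk w = Xi f g A B w + ereal (1 / (2 * \<gamma>) * sqnorm_M A B (w - wk))"

text \<open>One cycle of coordinate minimization, in the order of the index type \<open>'p\<close>: when coordinate
  \<open>i\<close> is treated, the smaller ones are already updated and the larger ones are those of \<open>wk\<close>.\<close>

definition coord_cycle ::
  "(real^'n \<Rightarrow> ereal) \<Rightarrow> (real^'m \<Rightarrow> ereal) \<Rightarrow> real^'n^'m \<Rightarrow> real^'n^'p::{finite,linorder} \<Rightarrow>
   real \<Rightarrow> real^'p::{finite,linorder} \<Rightarrow> ('m, 'p) dual \<Rightarrow> real^'p::{finite,linorder} \<Rightarrow> bool" where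
  "coord_cycle f g A B \<gamma> \<mu> wk zt \<longleftrightarrow>
     (\<forall>i. is_arg_min
        (\<lambda>t. Xi_k f g A B \<gamma> wk
               (fst wk, \<chi> l. if l < i then zt $ l else if l = i then t else snd wk $ l)
             + ereal (\<mu> $ i * of_bool (t \<noteq> 0)))
        (\<lambda>_. True) (zt $ i))"

definition supp :: "real^'p \<Rightarrow> 'p set" where
  "supp z = {i. z $ i \<noteq> 0}"

definition solves_D_k ::
  "(real^'n \<Rightarrow> ereal) \<Rightarrow> (real^'m \<Rightarrow> ereal) \<Rightarrow> real^'n^'m \<Rightarrow> real^'n^'p \<Rightarrow>
   real \<Rightarrow> ('m, 'p) dual \<Rightarrow> 'p set \<Rightarrow> ('m, 'p) dual \<Rightarrow> bool" where
  "solves_D_k f g A B \<gamma> wk T w \<longleftrightarrow>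
     is_arg_min (Xi_k f g A B \<gamma> wk) (\<lambda>w. \<forall>i. i \<notin> T \<longrightarrow> snd w $ i = 0) w"


section \<open>Primal problem\<close>

text \<open>The subvector \<open>z\<^sub>T\<close> and the row submatrix \<open>B\<^sub>T\<close> are padded with zeros outside
  \<open>T\<close>; this changes neither \<open>\<parallel>z\<^sub>T\<parallel>\<close> nor the product of \<open>B\<^sub>T\<close> transposed with \<open>B\<^sub>T\<close>.\<close>

definition restr_vec :: "'p set \<Rightarrow> real^'p \<Rightarrow> real^'p" where
  "restr_vec T z = (\<chi> i. if i \<in> T then z $ i else 0)"

definition restr_rows :: "'p set \<Rightarrow> real^'n^'p \<Rightarrow> real^'n^'p" where
  "restr_rows T B = (\<chi> i. if i \<in> T then B $ i else 0)"

definition f_k ::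
  "(real^'n \<Rightarrow> ereal) \<Rightarrow> real^'n^'m \<Rightarrow> real^'n^'p \<Rightarrow> real \<Rightarrow> ('m, 'p) dual \<Rightarrow>
   real^'n \<Rightarrow> real" where
  "f_k f A B \<gamma> wk x =
     moreau_env (1 / \<gamma>) f (x - (1 / \<gamma>) *\<^sub>R adjoint (Qmap A B) wk)
     - 1 / (2 * \<gamma>) * (norm (adjoint (Qmap A B) wk))\<^sup>2"

definition g_k ::
  "(real^'m \<Rightarrow> ereal) \<Rightarrow> real \<Rightarrow> ('m, 'p) dual \<Rightarrow> real^'m \<Rightarrow> real" where
  "g_k g \<gamma> wk u =
     moreau_env (1 / \<gamma>) g (u + (1 / \<gamma>) *\<^sub>R fst wk) - 1 / (2 * \<gamma>) * (norm (fst wk))\<^sup>2"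

definition h_k :: "real \<Rightarrow> ('m, 'p) dual \<Rightarrow> 'p set \<Rightarrow> real^'p \<Rightarrow> real" where
  "h_k \<gamma> wk T v =
     \<gamma> / 2 * (norm (restr_vec T (v + (1 / \<gamma>) *\<^sub>R snd wk)))\<^sup>2
     - 1 / (2 * \<gamma>) * (norm (snd wk))\<^sup>2"

definition Psi_k ::
  "(real^'n \<Rightarrow> ereal) \<Rightarrow> (real^'m \<Rightarrow> ereal) \<Rightarrow> real^'n^'m \<Rightarrow> real^'n^'p \<Rightarrow>
   real \<Rightarrow> ('m, 'p) dual \<Rightarrow> 'p set \<Rightarrow> real^'n \<Rightarrow> real" where
  "Psi_k f g A B \<gamma> wk T x =
     f_k f A B \<gamma> wk x + g_k g \<gamma> wk (A *v x) + h_k \<gamma> wk T (B *v x)"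

definition gap_k ::
  "(real^'n \<Rightarrow> ereal) \<Rightarrow> (real^'m \<Rightarrow> ereal) \<Rightarrow> real^'n^'m \<Rightarrow> real^'n^'p \<Rightarrow>
   real \<Rightarrow> ('m, 'p) dual \<Rightarrow> 'p set \<Rightarrow> real^'n \<Rightarrow> ('m, 'p) dual \<Rightarrow> ereal" where
  "gap_k f g A B \<gamma> wk T x w = ereal (Psi_k f g A B \<gamma> wk T x) + Xi_k f g A B \<gamma> wk w"

definition gen_hessian_k ::
  "(real^'n \<Rightarrow> ereal) \<Rightarrow> (real^'m \<Rightarrow> ereal) \<Rightarrow> real^'n^'m \<Rightarrow> real^'n^'p \<Rightarrow>
   real \<Rightarrow> ('m, 'p) dual \<Rightarrow> 'p set \<Rightarrow> real^'n \<Rightarrow> (real^'n^'n) set" where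
  "gen_hessian_k f g A B \<gamma> wk T x =
     {U + transpose A ** V ** A + \<gamma> *\<^sub>R (transpose (restr_rows T B) ** restr_rows T B) | U V.
        U \<in> clarke_jacobian (nabla (f_k f A B \<gamma> wk)) x \<and>
        V \<in> clarke_jacobian (nabla (g_k g \<gamma> wk)) (A *v x)}"


section \<open>The semismooth Newton algorithm\<close>

text \<open>Conjugate gradient method for \<open>K d = b\<close>, started at \<open>0\<close>. The state consists of the iterate,
  the residual and the search direction. Since \<open>0 / 0 = 0\<close>, the iterates stay constant once the
  residual vanishes.\<close>

primrec cg_state :: "real^'n^'n \<Rightarrow> real^'n \<Rightarrow> nat \<Rightarrow> (real^'n) \<times> (real^'n) \<times> (real^'n)" where
  "cg_state K b 0 = (0, b, b)"
| "cg_state K b (Suc i) =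
     (case cg_state K b i of (d, r, p) \<Rightarrow>
        let a = (r \<bullet> r) / (p \<bullet> (K *v p));
            r' = r - a *\<^sub>R (K *v p)
        in (d + a *\<^sub>R p, r', r' + ((r' \<bullet> r') / (r \<bullet> r)) *\<^sub>R p))"

definition cg_iterate :: "real^'n^'n \<Rightarrow> real^'n \<Rightarrow> nat \<Rightarrow> real^'n" where
  "cg_iterate K b i = fst (cg_state K b i)"

text \<open>The direction is any conjugate gradient iterate, after at least one step, that passes the
  residual test. Without the step the zero vector would be admissible whenever
  \<open>\<tau>2 * norm (\<nabla>\<Psi>) powr \<tau> \<ge> 1\<close>, and the algorithm could stall.\<close>

definition newton_direction ::
  "real \<Rightarrow> real \<Rightarrow> real \<Rightarrow> (real^'n \<Rightarrow> real) \<Rightarrow> (real^'n \<Rightarrow> (real^'n^'n) set) \<Rightarrow>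
   real^'n \<Rightarrow> real^'n \<Rightarrow> bool" where
  "newton_direction \<tau> \<tau>1 \<tau>2 \<Psi> Hess x d \<longleftrightarrow>
     (\<exists>H \<in> Hess x.
        let K = H + (\<tau>1 * norm (nabla \<Psi> x)) *\<^sub>R mat 1
        in (\<exists>i\<ge>1. d = cg_iterate K (- nabla \<Psi> x) i) \<and>
           norm (K *v d + nabla \<Psi> x) \<le> \<tau>2 * norm (nabla \<Psi> x) powr (1 + \<tau>))"

definition line_search_step ::
  "real \<Rightarrow> real \<Rightarrow> (real^'n \<Rightarrow> real) \<Rightarrow> real^'n \<Rightarrow> real^'n \<Rightarrow> real \<Rightarrow> bool" where
  "line_search_step \<beta> \<zeta> \<Psi> x d \<alpha> \<longleftrightarrow>
     (let ok = (\<lambda>q::nat. \<Psi> (x + \<beta> ^ q *\<^sub>R d) \<le> \<Psi> x + \<zeta> * \<beta> ^ q * (nabla \<Psi> x \<bullet> d))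
      in \<exists>q. ok q \<and> (\<forall>r<q. \<not> ok r) \<and> \<alpha> = \<beta> ^ q)"

definition dual_recovery ::
  "(real^'m \<Rightarrow> ereal) \<Rightarrow> real^'n^'m \<Rightarrow> real^'n^'p \<Rightarrow>
   real \<Rightarrow> ('m, 'p) dual \<Rightarrow> 'p set \<Rightarrow> real^'n \<Rightarrow> ('m, 'p) dual" where
  "dual_recovery g A B \<gamma> wk T x =
     (prox \<gamma> (fenchel_conj g) (\<gamma> *\<^sub>R (A *v x) + fst wk),
      \<chi> i. if i \<in> T then snd wk $ i + \<gamma> * (B *v x) $ i else 0)"

text \<open>\<open>(xb j, wb j)\<close> is the pair held after the dual recovery of pass \<open>j\<close>, which
  overwrites the dual starting point; the latter thus enters only through \<open>T\<close>.\<close>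

definition SNA_sequence ::
  "(real^'n \<Rightarrow> ereal) \<Rightarrow> (real^'m \<Rightarrow> ereal) \<Rightarrow> real^'n^'m \<Rightarrow> real^'n^'p \<Rightarrow>
   real \<Rightarrow> ('m, 'p) dual \<Rightarrow> 'p set \<Rightarrow>
   real \<Rightarrow> real \<Rightarrow> real \<Rightarrow> real \<Rightarrow> real \<Rightarrow> real^'n \<Rightarrow>
   (nat \<Rightarrow> real^'n) \<Rightarrow> (nat \<Rightarrow> ('m, 'p) dual) \<Rightarrow> bool" where
  "SNA_sequence f g A B \<gamma> wk T \<tau> \<tau>1 \<tau>2 \<beta> \<zeta> xk xb wb \<longleftrightarrow>
     xb 0 = xk \<and>
     (\<forall>j. \<exists>d \<alpha>.
        newton_direction \<tau> \<tau>1 \<tau>2 (Psi_k f g A B \<gamma> wk T) (gen_hessian_k f g A B \<gamma> wk T) (xb j) d \<and>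
        line_search_step \<beta> \<zeta> (Psi_k f g A B \<gamma> wk T) (xb j) d \<alpha> \<and>
        xb (Suc j) = xb j + \<alpha> *\<^sub>R d \<and>
        wb j = dual_recovery g A B \<gamma> wk T (xb j))"

end

(*
  Write G for the gradient of Psi_k. The recovered dual point w makes the Fenchel-Young inequality tight
  for g_k and h_k, and tight for f_k up to moving the argument of the conjugate by G(x); as coercivity
  of f makes the conjugate of f finite, hence locally Lipschitz, the gap is O(|G(x)|) on bounded sets.

  G tends to 0 along the iterates: elements of the generalized Hessian are symmetric, positive
  semidefinite and bounded, so after at least one step the orthogonality relations of conjugate gradients
  give |G|^2 <= c <-G, d>, while the residual test and the regularization tau1 |G| bound |d|. The upper
  quadratic bound on Psi_k keeps the Armijo steps large enough to force G to 0, and coercivity of Psi_k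
  keeps the iterates bounded.

  Weak duality, applied to the starting dual point as well, turns a small gap into (C1) and (C3)
  as soon as w stays away from w^k; it does since w^k is not a dual solution and
  the dual objective is lower semicontinuous.
*)
theory Submission
  imports Defs
begin

section \<open>Proximal points and Moreau envelopes\<close>

text \<open>The metric \<open>M\<close> makes duality split: the squared M-norm of
  \<open>w - wk\<close> is the sum of the squares of Q^T (w - w^k), y - y^k and z - z^k, one square
  for each of the three Fenchel-Young relations belonging to f_k, g_k and h_k.

  The obstacle is the f-block. The recovered \<open>w\<close> satisfies -Q^T w = s - G(x), where s
  is the gradient of f_k at x, while Fenchel-Young equality is available only at s itself. A priori
  the conjugate of f could be infinite at the nearby point -Q^T w, and the gap would then be
  infinite however small G(x) is.

  The Newton direction is shown to be bounded, not small: the residual test makes the norm of K d a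
  multiple of |G|, the regularization makes K at least tau1 |G|, and the factor |G| cancels. The
  line search analysis therefore runs on the scalar -<G, d>: each step decreases Psi_k by at least a
  multiple of the smaller of -<G, d> and its square, up to constants.\<close>

definition exact_subgrad :: "('a::euclidean_space \<Rightarrow> ereal) \<Rightarrow> 'a \<Rightarrow> real \<Rightarrow> 'a \<Rightarrow> bool" where
  "exact_subgrad \<psi> x r s \<longleftrightarrow> \<psi> x = ereal r \<and> (\<forall>u. ereal (r + s \<bullet> (u - x)) \<le> \<psi> u)"

lemma exact_subgradD:
  assumes "exact_subgrad \<psi> x r s"
  shows "\<psi> x = ereal r" "ereal (r + s \<bullet> (u - x)) \<le> \<psi> u"
  using assms by (auto simp: exact_subgrad_def)

text \<open>A point one unit below a finite value lies outside the closed convex epigraph. The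
  separating functional grows between that point and the graph point above it, so its vertical
  component \<open>\<rho>\<close> is positive and the hyperplane is the graph of an affine
  function.\<close>

lemma affine_minorant_exists:
  fixes \<psi> :: "'a::euclidean_space \<Rightarrow> ereal"
  assumes "proper_closed_convex \<psi>"
  obtains a b where "\<And>u. ereal (a \<bullet> u + b) \<le> \<psi> u"
proof -
  obtain x0 where x0: "\<psi> x0 \<noteq> \<infinity>" "\<psi> x0 \<noteq> -\<infinity>" and ni: "\<And>u. \<psi> u \<noteq> -\<infinity>"
    using assms by (auto simp: proper_closed_convex_def)
  then obtain r0 where r0: "\<psi> x0 = ereal r0" by (cases "\<psi> x0") auto
  have "convex (epi \<psi>)" "closed (epi \<psi>)" using assms by (auto simp: proper_closed_convex_def)
  moreover have "(x0, r0 - 1) \<notin> epi \<psi>" by (simp add: epi_def r0)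
  ultimately obtain a c where ac: "inner a (x0, r0 - 1) < c" "\<forall>x\<in>epi \<psi>. inner a x > c"
    using separating_hyperplane_closed_point by blast
  obtain a1 \<rho> where a: "a = (a1, \<rho>)" by (cases a)
  have "(x0, r0) \<in> epi \<psi>" by (simp add: epi_def r0)
  with ac a have "a1 \<bullet> x0 + \<rho> * (r0 - 1) < c" "a1 \<bullet> x0 + \<rho> * r0 > c" by auto
  then have "\<rho> > 0" by (simp add: algebra_simps)
  have "ereal ((- (1/\<rho>) *\<^sub>R a1) \<bullet> u + c/\<rho>) \<le> \<psi> u" for u
  proof (cases "\<psi> u")
    case (real r)
    then have "(u, r) \<in> epi \<psi>" by (simp add: epi_def)
    then have "a1 \<bullet> u + \<rho> * r > c" using ac a by auto
    then show ?thesis using real \<open>\<rho> > 0\<close> by (simp add: field_simps)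
  qed (use ni in auto)
  then show thesis using that by blast
qed

text \<open>The minimum is sought over the epigraph, where the objective becomes the continuous
  function \<open>F\<close> and closedness of the epigraph acts as lower semicontinuity. The
  sublevel set is bounded because the quadratic term outgrows an affine minorant.\<close>

lemma prox_obj_argmin_exists:
  fixes \<psi> :: "'a::euclidean_space \<Rightarrow> ereal"
  assumes "proper_closed_convex \<psi>" "\<sigma> > 0"
  obtains P where "is_arg_min (prox_obj \<sigma> \<psi> p) (\<lambda>_. True) P" "\<psi> P \<noteq> \<infinity>"
proof -
  obtain x0 where x0: "\<psi> x0 \<noteq> \<infinity>" and ni: "\<And>u. \<psi> u \<noteq> -\<infinity>"
    using assms by (auto simp: proper_closed_convex_def)
  then obtain r0 where r0: "\<psi> x0 = ereal r0" by (cases "\<psi> x0") auto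
  obtain a b where ab: "\<And>u. ereal (a \<bullet> u + b) \<le> \<psi> u"
    using affine_minorant_exists[OF assms(1)] by blast
  define F where "F = (\<lambda>z::'a \<times> real. 1 / (2 * \<sigma>) * (norm (fst z - p))\<^sup>2 + snd z)"
  define c where "c = F (x0, r0)"
  define S where "S = epi \<psi> \<inter> {z. F z \<le> c}"
  have contF: "continuous_on X F" for X unfolding F_def by (intro continuous_intros)
  have "closed S" unfolding S_def
  proof (rule closed_Int)
    show "closed (epi \<psi>)" using assms by (auto simp: proper_closed_convex_def)
    show "closed {z. F z \<le> c}" using contF by (intro closed_Collect_le) (auto intro: continuous_on_const)
  qed
  define d where "d = c - b - a \<bullet> p"
  \<comment> \<open>Once \<open>norm (u - p) \<ge> 1\<close>, the constant
    \<open>\<bar>d\<bar>\<close> may be multiplied by \<open>norm (u - p)\<close>, and dividing the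
    quadratic inequality by that norm leaves the first summand. The summand 1 guarantees
    \<open>N \<ge> 1\<close>.\<close>
  define N where "N = 2 * \<sigma> * (norm a + \<bar>d\<bar>) + 1"
  have "norm a \<ge> 0" by simp
  have "N \<ge> 1" using assms(2) by (simp add: N_def)
  have dist_bd: "norm (u - p) \<le> N" if "(u, r) \<in> S" for u r
  proof (rule ccontr)
    assume "\<not> ?thesis"
    then have l: "norm (u - p) > N" by simp
    have "\<psi> u \<le> ereal r" and "1 / (2 * \<sigma>) * (norm (u - p))\<^sup>2 + r \<le> c"
      using that by (auto simp: S_def epi_def F_def)
    moreover have "a \<bullet> u + b \<le> r" using order_trans[OF ab \<open>\<psi> u \<le> ereal r\<close>] by simp
    moreover have "a \<bullet> u = a \<bullet> p + a \<bullet> (u - p)" by (simp add: inner_diff_right)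
    moreover have "\<bar>a \<bullet> (u - p)\<bar> \<le> norm a * norm (u - p)" by (rule Cauchy_Schwarz_ineq2)
    ultimately have q: "1 / (2 * \<sigma>) * (norm (u - p))\<^sup>2 \<le> d + norm a * norm (u - p)"
      unfolding d_def by linarith
    have "\<bar>d\<bar> * 1 \<le> \<bar>d\<bar> * norm (u - p)" using l \<open>N \<ge> 1\<close> by (intro mult_left_mono) auto
    then have "d \<le> \<bar>d\<bar> * norm (u - p)" by linarith
    with q have "1 / (2 * \<sigma>) * (norm (u - p))\<^sup>2 \<le> (norm a + \<bar>d\<bar>) * norm (u - p)"
      by (simp add: algebra_simps)
    then have "(norm (u - p))\<^sup>2 \<le> (2 * \<sigma>) * ((norm a + \<bar>d\<bar>) * norm (u - p))"
      using assms(2) by (simp add: field_simps)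
    then have "norm (u - p) * norm (u - p) \<le> (2 * \<sigma> * (norm a + \<bar>d\<bar>)) * norm (u - p)"
      by (simp add: power2_eq_square algebra_simps)
    moreover have "norm (u - p) > 0" using l \<open>N \<ge> 1\<close> by linarith
    ultimately have "norm (u - p) \<le> 2 * \<sigma> * (norm a + \<bar>d\<bar>)"
      by (rule mult_right_le_imp_le)
    then show False using l by (simp add: N_def)
  qed
  have "bounded S"
  proof (rule bounded_subset)
    define M where "M = \<bar>c\<bar> + \<bar>a \<bullet> p + b\<bar> + norm a * N"
    show "S \<subseteq> cball p N \<times> cball 0 M"
    proof (clarsimp simp: dist_norm)
      fix u r assume S: "(u, r) \<in> S"
      have ur: "\<psi> u \<le> ereal r" and le: "1 / (2 * \<sigma>) * (norm (u - p))\<^sup>2 + r \<le> c"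
        using S by (auto simp: S_def epi_def F_def)
      have "a \<bullet> u + b \<le> r" using order_trans[OF ab ur] by simp
      moreover have "a \<bullet> u = a \<bullet> p + a \<bullet> (u - p)" by (simp add: inner_diff_right)
      moreover have "\<bar>a \<bullet> (u - p)\<bar> \<le> norm a * norm (u - p)" by (rule Cauchy_Schwarz_ineq2)
      moreover have "norm a * norm (u - p) \<le> norm a * N"
        using dist_bd[OF S] by (simp add: mult_left_mono)
      moreover have "1 / (2 * \<sigma>) * (norm (u - p))\<^sup>2 \<ge> 0" using assms(2) by simp
      ultimately have "\<bar>r\<bar> \<le> M" using le unfolding M_def by linarith
      then show "norm (p - u) \<le> N \<and> \<bar>r\<bar> \<le> M" using dist_bd[OF S] by (simp add: norm_minus_commute)
    qed
    show "bounded (cball p N \<times> cball 0 M)" by (intro bounded_Times bounded_cball)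
  qed
  with \<open>closed S\<close> have "compact S" by (simp add: compact_eq_bounded_closed)
  moreover have "(x0, r0) \<in> S" by (simp add: S_def epi_def r0 c_def)
  ultimately obtain z where z: "z \<in> S" "\<forall>y\<in>S. F z \<le> F y"
    using continuous_attains_inf[OF _ _ contF] by blast
  obtain P r where Pr: "z = (P, r)" by (cases z)
  have Pfin: "\<psi> P \<le> ereal r" using z Pr by (simp add: S_def epi_def)
  have "is_arg_min (prox_obj \<sigma> \<psi> p) (\<lambda>_. True) P"
    unfolding is_arg_min_linorder
  proof (intro conjI allI impI TrueI)
    fix u
    have "prox_obj \<sigma> \<psi> p P \<le> ereal (F z)"
      using add_left_mono[OF Pfin, of "ereal (1 / (2 * \<sigma>) * (norm (P - p))\<^sup>2)"]
      by (simp add: prox_obj_def F_def Pr)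
    also have "ereal (F z) \<le> prox_obj \<sigma> \<psi> p u"
    proof (cases "\<psi> u")
      case (real ru)
      have "F z \<le> F (u, ru)"
      proof (cases "F (u, ru) \<le> c")
        case True
        then show ?thesis using z real by (auto simp: S_def epi_def)
      next
        case False
        moreover have "F z \<le> c" using z by (simp add: S_def)
        ultimately show ?thesis by linarith
      qed
      then show ?thesis using real by (simp add: prox_obj_def F_def)
    qed (use ni in \<open>auto simp: prox_obj_def\<close>)
    finally show "prox_obj \<sigma> \<psi> p P \<le> prox_obj \<sigma> \<psi> p u" .
  qed
  moreover have "\<psi> P \<noteq> \<infinity>" using Pfin by auto
  ultimately show thesis using that by blast
qed

lemma convex_epi_combination:
  assumes "convex (epi \<psi>)" "\<psi> x = ereal r" "\<psi> u = ereal s" "0 \<le> t" "t \<le> 1"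
  shows "\<psi> (x + t *\<^sub>R (u - x)) \<le> ereal (r + t * (s - r))"
proof -
  have "(x, r) \<in> epi \<psi>" "(u, s) \<in> epi \<psi>" using assms by (auto simp: epi_def)
  then have "(1 - t) *\<^sub>R (x, r) + t *\<^sub>R (u, s) \<in> epi \<psi>"
    using assms(1,4,5) by (intro convexD) auto
  then show ?thesis by (simp add: epi_def algebra_simps)
qed

text \<open>Minimality is tested at \<open>P + t *\<^sub>R (u - P)\<close>: convexity bounds \<psi>
  there linearly in t, while the quadratic term contributes its derivative and a remainder of order
  t squared. Dividing by t and letting t tend to 0 leaves the subgradient inequality.\<close>

lemma prox_obj_argmin_subgrad:
  fixes \<psi> :: "'a::euclidean_space \<Rightarrow> ereal"
  assumes "proper_closed_convex \<psi>" "\<sigma> > 0"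
    and "is_arg_min (prox_obj \<sigma> \<psi> p) (\<lambda>_. True) P" "\<psi> P \<noteq> \<infinity>"
  obtains r where "exact_subgrad \<psi> P r ((1/\<sigma>) *\<^sub>R (p - P))"
proof -
  have ni: "\<And>u. \<psi> u \<noteq> -\<infinity>" using assms by (auto simp: proper_closed_convex_def)
  with assms(4) obtain r where r: "\<psi> P = ereal r" by (cases "\<psi> P") auto
  have le: "prox_obj \<sigma> \<psi> p P \<le> prox_obj \<sigma> \<psi> p u" for u
    using assms(3) by (simp add: is_arg_min_linorder)
  have "ereal (r + ((1/\<sigma>) *\<^sub>R (p - P)) \<bullet> (u - P)) \<le> \<psi> u" for u
  proof (cases "\<psi> u")
    case (real s)
    have *: "(1/\<sigma>) * ((p - P) \<bullet> (u - P)) - (s - r) \<le> t * ((norm (u - P))\<^sup>2 / (2*\<sigma>))" if t: "0 < t" "t \<le> 1" for t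
    proof -
      let ?v = "P + t *\<^sub>R (u - P)"
      have v: "\<psi> ?v \<le> ereal (r + t * (s - r))"
        using convex_epi_combination[of \<psi> P r u s t] assms(1) r real t
        by (auto simp: proper_closed_convex_def)
      have "ereal (1 / (2 * \<sigma>) * (norm (P - p))\<^sup>2 + r) \<le> ereal (1 / (2 * \<sigma>) * (norm (?v - p))\<^sup>2) + \<psi> ?v"
        using le[of ?v] by (simp add: prox_obj_def r)
      also have "\<dots> \<le> ereal (1 / (2 * \<sigma>) * (norm (?v - p))\<^sup>2 + (r + t * (s - r)))"
        using add_left_mono[OF v, of "ereal (1 / (2 * \<sigma>) * (norm (?v - p))\<^sup>2)"] by simp
      finally have "1 / (2 * \<sigma>) * (norm (P - p))\<^sup>2 \<le> 1 / (2 * \<sigma>) * (norm (?v - p))\<^sup>2 + t * (s - r)" by simp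
      moreover have "(norm (?v - p))\<^sup>2 = (norm (P - p))\<^sup>2 - 2 * t * ((p - P) \<bullet> (u - P)) + t * t * (norm (u - P))\<^sup>2"
        unfolding power2_norm_eq_inner by (simp add: algebra_simps inner_commute)
      then have "1 / (2 * \<sigma>) * (norm (?v - p))\<^sup>2 = 1 / (2 * \<sigma>) * (norm (P - p))\<^sup>2
          - t * ((1/\<sigma>) * ((p - P) \<bullet> (u - P))) + t * (t * ((norm (u - P))\<^sup>2 / (2*\<sigma>)))"
        using assms(2) by (simp only:) (simp add: field_simps)
      ultimately have "t * ((1/\<sigma>) * ((p - P) \<bullet> (u - P)) - (s - r)) \<le> t * (t * ((norm (u - P))\<^sup>2 / (2*\<sigma>)))"
        unfolding right_diff_distrib by linarith
      then show ?thesis using t(1) by (rule mult_left_le_imp_le)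
    qed
    have "((\<lambda>t. t * ((norm (u - P))\<^sup>2 / (2*\<sigma>))) \<longlongrightarrow> 0 * ((norm (u - P))\<^sup>2 / (2*\<sigma>))) (at_right 0)"
      by (intro tendsto_intros)
    moreover have "\<forall>\<^sub>F t in at_right 0. (1/\<sigma>) * ((p - P) \<bullet> (u - P)) - (s - r) \<le> t * ((norm (u - P))\<^sup>2 / (2*\<sigma>))"
      using eventually_at_right_less[of "0::real"] eventually_at_right_real[of 0 1] 
      by (rule eventually_elim2) (use * in auto)
    ultimately have "(1/\<sigma>) * ((p - P) \<bullet> (u - P)) - (s - r) \<le> 0 * ((norm (u - P))\<^sup>2 / (2*\<sigma>))"
      by (intro tendsto_lowerbound) auto
    then show ?thesis using real by simp
  qed (use ni in auto)
  with r show thesis using that by (auto simp: exact_subgrad_def)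
qed

text \<open>Completing the square around \<open>P\<close> turns the subgradient inequality into
  quadratic growth; the surplus square makes the minimizer unique.\<close>

lemma prox_obj_ge_of_subgrad:
  fixes \<psi> :: "'a::euclidean_space \<Rightarrow> ereal"
  assumes "\<sigma> > 0" "exact_subgrad \<psi> P r ((1/\<sigma>) *\<^sub>R (p - P))"
  shows "ereal (1 / (2 * \<sigma>) * (norm (P - p))\<^sup>2 + r + 1 / (2 * \<sigma>) * (norm (u - P))\<^sup>2) \<le> prox_obj \<sigma> \<psi> p u"
proof -
  have "(norm (u - p))\<^sup>2 = (norm (P - p))\<^sup>2 - 2 * ((p - P) \<bullet> (u - P)) + (norm (u - P))\<^sup>2"
    unfolding power2_norm_eq_inner by (simp add: algebra_simps inner_commute)
  then have "1 / (2 * \<sigma>) * (norm (P - p))\<^sup>2 + r + 1 / (2 * \<sigma>) * (norm (u - P))\<^sup>2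
    = 1 / (2 * \<sigma>) * (norm (u - p))\<^sup>2 + (r + ((1/\<sigma>) *\<^sub>R (p - P)) \<bullet> (u - P))"
    using assms(1) by (simp only: inner_scaleR_left) (simp add: field_simps)
  then show ?thesis
    using add_left_mono[OF exact_subgradD(2)[OF assms(2), of u], of "ereal (1 / (2 * \<sigma>) * (norm (u - p))\<^sup>2)"]
    unfolding prox_obj_def plus_ereal.simps by (simp only:)
qed

text \<open>A single subgradient certificate identifies both the point selected by
  \<open>THE\<close> and the value of the infimum. It applies to conjugates too, which is how
  \<open>prox_fenchel_conj\<close> evaluates the dual recovery.\<close>

lemma prox_of_subgrad:
  fixes \<psi> :: "'a::euclidean_space \<Rightarrow> ereal"
  assumes "\<sigma> > 0" "exact_subgrad \<psi> P r ((1/\<sigma>) *\<^sub>R (p - P))"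
  shows "prox \<sigma> \<psi> p = P"
    and "moreau_env \<sigma> \<psi> p = 1 / (2 * \<sigma>) * (norm (P - p))\<^sup>2 + r"
proof -
  note ge = prox_obj_ge_of_subgrad[OF assms]
  let ?m = "1 / (2 * \<sigma>) * (norm (P - p))\<^sup>2 + r"
  have P: "prox_obj \<sigma> \<psi> p P = ereal ?m"
    using exact_subgradD(1)[OF assms(2)] by (simp add: prox_obj_def)
  have min: "ereal ?m \<le> prox_obj \<sigma> \<psi> p u" for u
    by (rule order_trans[OF _ ge]) (use assms(1) in simp)
  show "prox \<sigma> \<psi> p = P"
    unfolding prox_def
  proof (rule the_equality)
    show "is_arg_min (prox_obj \<sigma> \<psi> p) (\<lambda>_. True) P"
      using min P by (simp add: is_arg_min_linorder)
    fix u assume "is_arg_min (prox_obj \<sigma> \<psi> p) (\<lambda>_. True) u"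
    then have "prox_obj \<sigma> \<psi> p u \<le> ereal ?m"
      unfolding P[symmetric] by (simp only: is_arg_min_linorder)
    then have "?m + 1 / (2 * \<sigma>) * (norm (u - P))\<^sup>2 \<le> ?m"
      using order_trans[OF ge[of u], of "ereal ?m"] unfolding ereal_less_eq by blast
    then have "1 / (2 * \<sigma>) * (norm (u - P))\<^sup>2 \<le> 0" by linarith
    then show "u = P" using assms(1) by (simp add: mult_le_0_iff divide_le_0_iff)
  qed
  have "(INF u. prox_obj \<sigma> \<psi> p u) = ereal ?m"
  proof (rule INF_eqI)
    show "ereal ?m \<le> prox_obj \<sigma> \<psi> p u" for u by (rule min)
    show "y \<le> ereal ?m" if "\<And>u. u \<in> UNIV \<Longrightarrow> y \<le> prox_obj \<sigma> \<psi> p u" for y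
      using that[of P] by (simp add: P)
  qed
  then show "moreau_env \<sigma> \<psi> p = ?m" by (simp add: moreau_env_def)
qed

lemma prox_subgrad:
  fixes \<psi> :: "'a::euclidean_space \<Rightarrow> ereal"
  assumes "proper_closed_convex \<psi>" "\<sigma> > 0"
  obtains r where "exact_subgrad \<psi> (prox \<sigma> \<psi> p) r ((1/\<sigma>) *\<^sub>R (p - prox \<sigma> \<psi> p))"
proof -
  obtain P where "is_arg_min (prox_obj \<sigma> \<psi> p) (\<lambda>_. True) P" "\<psi> P \<noteq> \<infinity>"
    using prox_obj_argmin_exists[OF assms] .
  then obtain r where "exact_subgrad \<psi> P r ((1/\<sigma>) *\<^sub>R (p - P))"
    using prox_obj_argmin_subgrad[OF assms] by blast
  with prox_of_subgrad(1)[OF assms(2) this] show thesis using that by simp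
qed

section \<open>Values and subgradients of Fenchel conjugates\<close>

lemma fenchel_conj_ge:
  assumes "\<psi> x = ereal r"
  shows "ereal (s \<bullet> x - r) \<le> fenchel_conj \<psi> s"
  unfolding fenchel_conj_def using assms by (intro SUP_upper2[of x]) auto

lemma fenchel_conj_of_subgrad:
  assumes "exact_subgrad \<psi> x r s"
  shows "fenchel_conj \<psi> s = ereal (s \<bullet> x - r)"
proof (rule antisym)
  show "fenchel_conj \<psi> s \<le> ereal (s \<bullet> x - r)"
    unfolding fenchel_conj_def
  proof (rule SUP_least)
    fix u
    show "ereal (s \<bullet> u) - \<psi> u \<le> ereal (s \<bullet> x - r)"
      using exact_subgradD(2)[OF assms, of u]
      by (cases "\<psi> u") (auto simp: inner_diff_right)
  qed
  show "ereal (s \<bullet> x - r) \<le> fenchel_conj \<psi> s"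
    by (rule fenchel_conj_ge[where \<psi> = \<psi>, OF exact_subgradD(1)[OF assms]])
qed

lemma fenchel_conj_subgrad:
  assumes "exact_subgrad \<psi> x r s"
  shows "exact_subgrad (fenchel_conj \<psi>) s (s \<bullet> x - r) x"
  unfolding exact_subgrad_def
proof (intro conjI allI)
  show "fenchel_conj \<psi> s = ereal (s \<bullet> x - r)" by (rule fenchel_conj_of_subgrad[OF assms])
  fix u
  show "ereal (s \<bullet> x - r + x \<bullet> (u - s)) \<le> fenchel_conj \<psi> u"
    using fenchel_conj_ge[of \<psi> x r u] exact_subgradD(1)[OF assms]
    by (simp add: inner_diff_right inner_commute)
qed

subsection \<open>Coercivity and conjugates\<close>

lemma coercive_lower_bound:
  fixes \<psi> :: "'a::euclidean_space \<Rightarrow> ereal"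
  assumes "proper_closed_convex \<psi>" "coercive \<psi>" "0 \<le> R"
  obtains C where "\<And>u. ereal (R * norm u - C) \<le> \<psi> u"
proof -
  have "ereal R < Liminf at_infinity (\<lambda>x. \<psi> x / ereal (norm x))"
    using assms(2) by (simp add: coercive_def)
  then have "\<forall>\<^sub>F x in at_infinity. ereal R < \<psi> x / ereal (norm x)"
    by (rule less_LiminfD)
  then obtain b where b: "\<And>x. b \<le> norm x \<Longrightarrow> ereal R < \<psi> x / ereal (norm x)"
    by (auto simp: eventually_at_infinity)
  obtain a c where ac: "\<And>u. ereal (a \<bullet> u + c) \<le> \<psi> u"
    using affine_minorant_exists[OF assms(1)] by blast
  \<comment> \<open>Outside the ball of radius \<open>D\<close> the limit inferior gives the bound,
    and \<open>D \<ge> 1\<close> keeps the divisor positive; inside it the affine minorant does, at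
    the price of the constant \<open>C\<close>.\<close>
  define D where "D = max b 1"
  define C where "C = R * D + norm a * D + \<bar>c\<bar>"
  have D: "D \<ge> 1" "D \<ge> b" by (auto simp: D_def)
  then have C0: "C \<ge> 0" using assms(3) by (simp add: C_def)
  have "ereal (R * norm u - C) \<le> \<psi> u" for u
  proof (cases "norm u < D")
    case True
    have "\<bar>a \<bullet> u\<bar> \<le> norm a * norm u" by (rule Cauchy_Schwarz_ineq2)
    moreover have "norm a * norm u \<le> norm a * D" "R * norm u \<le> R * D"
      using True assms(3) by (auto intro: mult_left_mono)
    ultimately have "R * norm u - C \<le> a \<bullet> u + c" unfolding C_def by linarith
    then show ?thesis using ac[of u] by (meson ereal_less_eq(3) order_trans)
  next
    case False
    then have u: "norm u > 0" "b \<le> norm u" using D by auto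
    show ?thesis
    proof (cases "\<psi> u")
      case (real r)
      then have "R < r / norm u" using b[OF u(2)] u(1) by simp
      then show ?thesis using real u(1) C0 by (simp add: field_simps)
    next
      case MInf
      then show ?thesis using ac[of u] by simp
    qed auto
  qed
  then show thesis using that by blast
qed

text \<open>By convexity of the conjugate, the estimate compares \<open>s - e\<close> with the point at distance one from \<open>s\<close> in the same direction.\<close>

lemma fenchel_conj_locally_lipschitz:
  fixes \<psi> :: "'a::euclidean_space \<Rightarrow> ereal"
  assumes "proper_closed_convex \<psi>" "coercive \<psi>"
  obtains K where "0 \<le> K" "\<And>s e a. norm s \<le> R \<Longrightarrow> norm e \<le> 1 \<Longrightarrow> fenchel_conj \<psi> s = ereal a \<Longrightarrow>
    fenchel_conj \<psi> (s - e) \<le> ereal (a + K * norm e)"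
proof -
  obtain C where C: "\<And>u. ereal ((\<bar>R\<bar> + 1) * norm u - C) \<le> \<psi> u"
    using coercive_lower_bound[OF assms, of "\<bar>R\<bar> + 1"] by auto
  obtain x0 where x0: "\<psi> x0 \<noteq> \<infinity>" and ni: "\<And>u. \<psi> u \<noteq> -\<infinity>"
    using assms by (auto simp: proper_closed_convex_def)
  then obtain r0 where r0: "\<psi> x0 = ereal r0" by (cases "\<psi> x0") auto
  \<comment> \<open>\<open>C\<close> bounds the conjugate from above on the ball of radius
    \<open>\<bar>R\<bar> + 1\<close>, and the finite value of \<psi> at \<open>x0\<close> bounds
    \<open>a\<close> from below; \<open>K\<close> dominates the difference
    \<open>C - a\<close>.\<close>
  define K where "K = \<bar>C\<bar> + \<bar>R\<bar> * norm x0 + \<bar>r0\<bar>"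
  have K0: "0 \<le> K" by (simp add: K_def)
  have "fenchel_conj \<psi> (s - e) \<le> ereal (a + K * norm e)"
    if s: "norm s \<le> R" and e: "norm e \<le> 1" and a: "fenchel_conj \<psi> s = ereal a" for s e a
  proof (cases "e = 0")
    case False
    define t where "t = norm e"
    have t: "0 < t" "t \<le> 1" using False e by (auto simp: t_def)
    define s' where "s' = s - (1/t) *\<^sub>R e"
    have "norm s' \<le> norm s + norm ((1/t) *\<^sub>R e)" unfolding s'_def by (rule norm_triangle_ineq4)
    also have "norm ((1/t) *\<^sub>R e) = 1" using False by (simp add: t_def)
    finally have s': "norm s' \<le> \<bar>R\<bar> + 1" using s by linarith
    have "ereal (s \<bullet> x0 - r0) \<le> ereal a" using fenchel_conj_ge[of \<psi> x0 r0 s] r0 a by simp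
    moreover have "\<bar>s \<bullet> x0\<bar> \<le> norm s * norm x0" by (rule Cauchy_Schwarz_ineq2)
    moreover have "norm s * norm x0 \<le> \<bar>R\<bar> * norm x0" using s by (intro mult_right_mono) auto
    ultimately have Ca: "C - a \<le> K" unfolding K_def by simp
    show ?thesis
      unfolding fenchel_conj_def
    proof (rule SUP_least)
      fix u
      show "ereal ((s - e) \<bullet> u) - \<psi> u \<le> ereal (a + K * norm e)"
      proof (cases "\<psi> u")
        case (real r)
        have "s' \<bullet> u \<le> norm s' * norm u" by (rule norm_cauchy_schwarz)
        also have "\<dots> \<le> (\<bar>R\<bar> + 1) * norm u" using s' by (intro mult_right_mono) auto
        finally have 1: "s' \<bullet> u - r \<le> C" using C[of u] real by simp
        have 2: "s \<bullet> u - r \<le> a" using fenchel_conj_ge[of \<psi> u r s] real a by simp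
        have "(s - e) \<bullet> u - r = (1 - t) * (s \<bullet> u - r) + t * (s' \<bullet> u - r)"
          using t by (simp add: s'_def algebra_simps)
        also have "\<dots> \<le> (1 - t) * a + t * C"
          using 1 2 t by (intro add_mono mult_left_mono) auto
        also have "\<dots> = a + t * (C - a)" by (simp add: algebra_simps)
        also have "\<dots> \<le> a + t * K" using Ca t by (intro add_left_mono mult_left_mono) auto
        finally show ?thesis using real by (simp add: t_def mult.commute)
      qed (use ni in auto)
    qed
  qed (use a in simp)
  with K0 show thesis using that by blast
qed

subsection \<open>Convex functions with a quadratic upper bound\<close>

text \<open>The gradient inequality of convexity joined with the descent inequality of an
  L-Lipschitz gradient. In this form the property is stable under sums and linear substitution, and
  it determines differentiability, the gradient and its growth.\<close>

definition smooth_convex :: "real \<Rightarrow> ('a::euclidean_space \<Rightarrow> real) \<Rightarrow> ('a \<Rightarrow> 'a) \<Rightarrow> bool" where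
  "smooth_convex L \<phi> G \<longleftrightarrow> 0 \<le> L \<and> (\<forall>x h. \<phi> x + G x \<bullet> h \<le> \<phi> (x + h) \<and>
      \<phi> (x + h) \<le> \<phi> x + G x \<bullet> h + L / 2 * (norm h)\<^sup>2)"

lemma smooth_convexD:
  assumes "smooth_convex L \<phi> G"
  shows "0 \<le> L" "\<phi> x + G x \<bullet> h \<le> \<phi> (x + h)"
    "\<phi> (x + h) \<le> \<phi> x + G x \<bullet> h + L / 2 * (norm h)\<^sup>2"
  using assms by (auto simp: smooth_convex_def)

lemma smooth_convex_add:
  assumes "smooth_convex L \<phi> G" "smooth_convex L' \<phi>' G'"
  shows "smooth_convex (L + L') (\<lambda>x. \<phi> x + \<phi>' x) (\<lambda>x. G x + G' x)"
  unfolding smooth_convex_def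
proof (intro conjI allI)
  fix x h
  note * = smooth_convexD(1)[OF assms(1)] smooth_convexD(1)[OF assms(2)]
    smooth_convexD(2,3)[OF assms(1), of x h] smooth_convexD(2,3)[OF assms(2), of x h]
  show "0 \<le> L + L'" using * by simp
  show "\<phi> x + \<phi>' x + (G x + G' x) \<bullet> h \<le> \<phi> (x + h) + \<phi>' (x + h)"
    using * by (simp add: inner_add_left)
  show "\<phi> (x + h) + \<phi>' (x + h) \<le> \<phi> x + \<phi>' x + (G x + G' x) \<bullet> h + (L + L') / 2 * (norm h)\<^sup>2"
    using * by (simp add: inner_add_left add_divide_distrib distrib_right)
qed

lemma smooth_convex_matrix:
  fixes A :: "real^'n^'m"
  assumes "smooth_convex L \<phi> G"
  obtains L' where "smooth_convex L' (\<lambda>x. \<phi> (A *v x)) (\<lambda>x. transpose A *v G (A *v x))"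
proof -
  define K where "K = onorm ((*v) A)"
  have K: "norm (A *v h) \<le> K * norm h" for h
    unfolding K_def by (rule onorm) (rule matrix_vector_mul_bounded_linear)
  have "smooth_convex (L * K\<^sup>2) (\<lambda>x. \<phi> (A *v x)) (\<lambda>x. transpose A *v G (A *v x))"
    unfolding smooth_convex_def
  proof (intro conjI allI)
    fix x h
    note * = smooth_convexD(1)[OF assms] smooth_convexD(2,3)[OF assms, of "A *v x" "A *v h"]
    have eq: "(transpose A *v G (A *v x)) \<bullet> h = G (A *v x) \<bullet> (A *v h)"
      by (metis dot_lmul_matrix transpose_matrix_vector)
    show "0 \<le> L * K\<^sup>2" using *(1) by simp
    show "\<phi> (A *v x) + (transpose A *v G (A *v x)) \<bullet> h \<le> \<phi> (A *v (x + h))"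
      using *(2) by (simp add: eq matrix_vector_right_distrib del: transpose_matrix_vector)
    have "(norm (A *v h))\<^sup>2 \<le> (K * norm h)\<^sup>2" by (intro power_mono K) simp
    then have "L / 2 * (norm (A *v h))\<^sup>2 \<le> L / 2 * (K * norm h)\<^sup>2"
      using *(1) by (intro mult_left_mono) auto
    then show "\<phi> (A *v (x + h)) \<le> \<phi> (A *v x) + (transpose A *v G (A *v x)) \<bullet> h + L * K\<^sup>2 / 2 * (norm h)\<^sup>2"
      using *(3) by (simp add: eq matrix_vector_right_distrib power_mult_distrib del: transpose_matrix_vector)
  qed
  then show thesis using that by blast
qed

lemma smooth_convex_gderiv:
  assumes "smooth_convex L \<phi> G"
  shows "GDERIV \<phi> x :> G x"
  unfolding gderiv_def has_derivative_at
proof (intro conjI)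
  show "bounded_linear (\<lambda>h. h \<bullet> G x)" by (rule bounded_linear_inner_left)
  have bound: "norm (norm (\<phi> (x + h) - \<phi> x - h \<bullet> G x) / norm h) \<le> L / 2 * norm h" for h
  proof -
    have "norm (\<phi> (x + h) - \<phi> x - h \<bullet> G x) \<le> L / 2 * norm h * norm h"
      using smooth_convexD(2,3)[OF assms, of x h] by (simp add: inner_commute power2_eq_square)
    then show ?thesis using smooth_convexD(1)[OF assms] by (cases "h = 0") (simp_all add: divide_le_eq)
  qed
  have "((\<lambda>h::'a. L / 2 * norm h) \<longlongrightarrow> L / 2 * norm (0::'a)) (at 0)"
    by (intro tendsto_intros)
  then have lim: "((\<lambda>h::'a. L / 2 * norm h) \<longlongrightarrow> 0) (at 0)" by (simp only: norm_zero mult_zero_right)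
  show "(\<lambda>h. norm (\<phi> (x + h) - \<phi> x - h \<bullet> G x) / norm h) \<midarrow>0\<rightarrow> 0"
    by (rule Lim_null_comparison[OF always_eventually lim]) (intro allI bound)
qed

lemma smooth_convex_nabla:
  assumes "smooth_convex L \<phi> G"
  shows "nabla \<phi> = G"
proof
  fix x
  show "nabla \<phi> x = G x"
    unfolding nabla_def
  proof (rule the_equality)
    fix D assume "GDERIV \<phi> x :> D"
    then have "(\<lambda>h. h \<bullet> D) = (\<lambda>h. h \<bullet> G x)"
      using smooth_convex_gderiv[OF assms] unfolding gderiv_def by (rule has_derivative_unique)
    then show "D = G x" by (metis inner_commute inner_eq_zero_iff inner_diff_right right_minus_eq)
  qed (rule smooth_convex_gderiv[OF assms])
qed

text \<open>The gradient inequality along the unit vector in the direction \<open>G x\<close> bounds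
  \<open>norm (G x)\<close> by an increment of \<phi>, whose two ends are then compared with the
  expansion at 0. The purpose is boundedness of the gradient on bounded sets.\<close>

lemma smooth_convex_gradient_growth:
  assumes "smooth_convex L \<phi> G"
  shows "norm (G x) \<le> norm (G 0) + L / 2 * (norm x + 1)\<^sup>2"
proof -
  define h where "h = sgn (G x)"
  have h1: "norm h \<le> 1" by (simp add: h_def norm_sgn)
  have "G x \<bullet> h = norm (G x)"
    by (cases "G x = 0") (simp_all add: h_def sgn_div_norm power2_norm_eq_inner[symmetric] power2_eq_square)
  then have "norm (G x) \<le> \<phi> (x + h) - \<phi> x" using smooth_convexD(2)[OF assms, of x h] by simp
  also have "\<dots> \<le> G 0 \<bullet> h + L / 2 * (norm (x + h))\<^sup>2"
    using smooth_convexD(3)[OF assms, of 0 "x + h"] smooth_convexD(2)[OF assms, of 0 x]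
    by (simp add: inner_add_right)
  also have "G 0 \<bullet> h \<le> norm (G 0) * norm h" by (rule norm_cauchy_schwarz)
  also have "\<dots> \<le> norm (G 0)" using h1 by (simp add: mult_left_le)
  also have "L / 2 * (norm (x + h))\<^sup>2 \<le> L / 2 * (norm x + 1)\<^sup>2"
    using norm_triangle_ineq[of x h] h1 smooth_convexD(1)[OF assms]
    by (intro mult_left_mono power_mono) auto
  finally show ?thesis by simp
qed

subsection \<open>Derivatives of gradients\<close>

lemma le_of_le_add_small:
  fixes a b c :: real
  assumes "\<And>e. e > 0 \<Longrightarrow> a \<le> b + e * c"
  shows "a \<le> b"
proof (rule tendsto_lowerbound)
  show "((\<lambda>e. b + e * c) \<longlongrightarrow> b) (at_right 0)" by (rule tendsto_eq_intros | simp)+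
  show "\<forall>\<^sub>F e in at_right 0. a \<le> b + e * c"
    using eventually_at_right_less[of "0::real"] by eventually_elim (rule assms)
qed simp

lemma has_derivative_remainder_bound:
  assumes "(G has_derivative J) (at x)" "e > 0"
  obtains d where "d > 0" "\<And>h. norm h < d \<Longrightarrow> norm (G (x + h) - G x - J h) \<le> e * norm h"
proof -
  have "\<exists>d>0. \<forall>y. norm (y - x) < d \<longrightarrow> norm (G y - G x - J (y - x)) \<le> e * norm (y - x)"
    using assms by (auto simp: has_derivative_at_alt)
  then obtain d where "d > 0" "\<forall>y. norm (y - x) < d \<longrightarrow> norm (G y - G x - J (y - x)) \<le> e * norm (y - x)"
    by blast
  then show thesis using that[of d] by (metis add_diff_cancel_left')
qed

text \<open>\<open>G\<close> is assumed differentiable at the single point x only. The mean value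
  theorem is therefore applied to the difference of \<phi> along two parallel segments, which
  involves \<open>G\<close> alone, and \<open>J\<close> expands the two gradients that
  appear.\<close>

lemma gradient_second_difference:
  fixes \<phi> :: "'a::euclidean_space \<Rightarrow> real"
  assumes gd: "\<And>x. GDERIV \<phi> x :> G x" and J: "(G has_derivative J) (at x)" and "e > 0"
  obtains d where "d > 0"
    "\<And>t. 0 < t \<Longrightarrow> t < d \<Longrightarrow>
      \<bar>\<phi> (x + t *\<^sub>R u + t *\<^sub>R v) - \<phi> (x + t *\<^sub>R u) - \<phi> (x + t *\<^sub>R v) + \<phi> x - t * t * (J u \<bullet> v)\<bar>
        \<le> e * (t * t) * (norm v * (norm u + 2 * norm v))"
proof -
  obtain d0 where d0: "d0 > 0" "\<And>h. norm h < d0 \<Longrightarrow> norm (G (x + h) - G x - J h) \<le> e * norm h"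
    using has_derivative_remainder_bound[OF J \<open>e > 0\<close>] by blast
  define N where "N = norm u + norm v + 1"
  have N: "N > 0" unfolding N_def by (smt (verit) norm_ge_zero)
  interpret J: bounded_linear J using J by (rule has_derivative_bounded_linear)
  have "\<bar>\<phi> (x + t *\<^sub>R u + t *\<^sub>R v) - \<phi> (x + t *\<^sub>R u) - \<phi> (x + t *\<^sub>R v) + \<phi> x - t * t * (J u \<bullet> v)\<bar>
        \<le> e * (t * t) * (norm v * (norm u + 2 * norm v))" if t: "0 < t" "t < d0 / N" for t
  proof -
    define F where "F = (\<lambda>s. \<phi> (x + t *\<^sub>R u + s *\<^sub>R (t *\<^sub>R v)) - \<phi> (x + s *\<^sub>R (t *\<^sub>R v)))"
    have line: "((\<lambda>s. \<phi> (y + s *\<^sub>R w)) has_real_derivative G (y + s *\<^sub>R w) \<bullet> w) (at s)" for y w s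
    proof -
      have "((\<lambda>s. y + s *\<^sub>R w) has_derivative (\<lambda>s. s *\<^sub>R w)) (at s)"
        by (auto intro!: derivative_eq_intros)
      from has_derivative_compose[OF this gd[unfolded gderiv_def]]
      have "((\<lambda>s. \<phi> (y + s *\<^sub>R w)) has_derivative (\<lambda>h. (h *\<^sub>R w) \<bullet> G (y + s *\<^sub>R w))) (at s)" .
      moreover have "(\<lambda>h. (h *\<^sub>R w) \<bullet> G (y + s *\<^sub>R w)) = (*) (G (y + s *\<^sub>R w) \<bullet> w)"
        by (auto simp: inner_commute)
      ultimately show ?thesis by (simp add: has_field_derivative_def)
    qed
    define F' where "F' = (\<lambda>s. (G (x + t *\<^sub>R u + s *\<^sub>R (t *\<^sub>R v)) - G (x + s *\<^sub>R (t *\<^sub>R v))) \<bullet> (t *\<^sub>R v))"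
    have "DERIV F s :> F' s" for s
      unfolding F_def F'_def inner_diff_left by (intro DERIV_diff line)
    then obtain s where s: "0 < s" "s < 1" "F 1 - F 0 = (1 - 0) * F' s"
      using MVT2[of 0 1 F F'] by auto
    \<comment> \<open>The mean value point lies at these displacements on the two segments; as
      \<open>h1 - h2 = t *\<^sub>R u\<close>, the first-order parts combine to
      \<open>J (t *\<^sub>R u)\<close>.\<close>
    define h1 where "h1 = t *\<^sub>R (u + s *\<^sub>R v)"
    define h2 where "h2 = t *\<^sub>R (s *\<^sub>R v)"
    have sv: "norm (s *\<^sub>R v) \<le> norm v" using s by (simp add: mult_left_le_one_le)
    have n2: "norm h2 \<le> t * norm v"
      unfolding h2_def norm_scaleR[of t] using t by (simp only: abs_of_pos) (intro mult_left_mono sv, simp)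
    have n1: "norm h1 \<le> t * (norm u + norm v)"
      using norm_triangle_ineq[of u "s *\<^sub>R v"] sv t by (simp add: h1_def)
    have tN: "t * N < d0" using t N by (simp add: field_simps)
    have "t * (norm u + norm v) \<le> t * N" "t * norm v \<le> t * N"
      using t by (auto simp: N_def intro!: mult_left_mono)
    with n1 n2 tN have lt: "norm h1 < d0" "norm h2 < d0" by linarith+
    have rem: "norm (G (x + h1) - G (x + h2) - J (t *\<^sub>R u)) \<le> e * (t * (norm u + 2 * norm v))"
    proof -
      have "J h1 - J h2 = J (t *\<^sub>R u)"
        unfolding J.diff[symmetric] h1_def h2_def by (simp add: scaleR_right_distrib)
      then have "G (x + h1) - G (x + h2) - J (t *\<^sub>R u) = (G (x + h1) - G x - J h1) - (G (x + h2) - G x - J h2)"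
        by (simp add: algebra_simps)
      then have "norm (G (x + h1) - G (x + h2) - J (t *\<^sub>R u)) \<le> norm (G (x + h1) - G x - J h1) + norm (G (x + h2) - G x - J h2)"
        by (simp only:) (rule norm_triangle_ineq4)
      also have "\<dots> \<le> e * norm h1 + e * norm h2" by (intro add_mono d0(2) lt)
      also have "\<dots> \<le> e * (t * (norm u + norm v)) + e * (t * norm v)"
        using n1 n2 \<open>e > 0\<close> by (intro add_mono mult_left_mono) auto
      finally show ?thesis by (simp add: algebra_simps)
    qed
    have "F' s = (G (x + h1) - G (x + h2)) \<bullet> (t *\<^sub>R v)"
      by (simp add: F'_def h1_def h2_def algebra_simps)
    then have "F' s - t * t * (J u \<bullet> v) = (G (x + h1) - G (x + h2) - J (t *\<^sub>R u)) \<bullet> (t *\<^sub>R v)"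
      by (simp add: J.scaleR inner_diff_left right_diff_distrib)
    then have "\<bar>F' s - t * t * (J u \<bullet> v)\<bar> \<le> norm (G (x + h1) - G (x + h2) - J (t *\<^sub>R u)) * norm (t *\<^sub>R v)"
      by (simp only:) (rule Cauchy_Schwarz_ineq2)
    also have "\<dots> \<le> (e * (t * (norm u + 2 * norm v))) * norm (t *\<^sub>R v)"
      by (rule mult_right_mono[OF rem]) simp
    also have "\<dots> = e * (t * t) * (norm v * (norm u + 2 * norm v))"
      using t by simp
    finally have "\<bar>F' s - t * t * (J u \<bullet> v)\<bar> \<le> e * (t * t) * (norm v * (norm u + 2 * norm v))" .
    moreover have "\<phi> (x + t *\<^sub>R u + t *\<^sub>R v) - \<phi> (x + t *\<^sub>R u) - \<phi> (x + t *\<^sub>R v) + \<phi> x = F' s"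
      using s(3) by (simp add: F_def)
    ultimately show ?thesis by simp
  qed
  moreover have "d0 / N > 0" using d0(1) N by simp
  ultimately show thesis using that by blast
qed

text \<open>The second difference is unchanged when u and v are exchanged, so its two expansions
  agree up to an arbitrarily small multiple of t squared.\<close>

lemma gradient_derivative_symmetric:
  fixes \<phi> :: "'a::euclidean_space \<Rightarrow> real"
  assumes gd: "\<And>x. GDERIV \<phi> x :> G x" and J: "(G has_derivative J) (at x)"
  shows "J u \<bullet> v = J v \<bullet> u"
proof -
  define C where "C = norm v * (norm u + 2 * norm v) + norm u * (norm v + 2 * norm u)"
  have "\<bar>J u \<bullet> v - J v \<bullet> u\<bar> \<le> 0 + e * C" if "e > 0" for e
  proof -
    obtain d where d: "d > 0" "\<And>t. 0 < t \<Longrightarrow> t < d \<Longrightarrow>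
      \<bar>\<phi> (x + t *\<^sub>R u + t *\<^sub>R v) - \<phi> (x + t *\<^sub>R u) - \<phi> (x + t *\<^sub>R v) + \<phi> x - t * t * (J u \<bullet> v)\<bar>
        \<le> e * (t * t) * (norm v * (norm u + 2 * norm v))"
      using gradient_second_difference[OF gd J \<open>e > 0\<close>, where u = u and v = v] by blast
    obtain d' where d': "d' > 0" "\<And>t. 0 < t \<Longrightarrow> t < d' \<Longrightarrow>
      \<bar>\<phi> (x + t *\<^sub>R v + t *\<^sub>R u) - \<phi> (x + t *\<^sub>R v) - \<phi> (x + t *\<^sub>R u) + \<phi> x - t * t * (J v \<bullet> u)\<bar>
        \<le> e * (t * t) * (norm u * (norm v + 2 * norm u))"
      using gradient_second_difference[OF gd J \<open>e > 0\<close>, where u = v and v = u] by blast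
    define t where "t = min d d' / 2"
    have t: "0 < t" "t < d" "t < d'" using d(1) d'(1) by (auto simp: t_def)
    have "x + t *\<^sub>R v + t *\<^sub>R u = x + t *\<^sub>R u + t *\<^sub>R v" by simp
    with d(2)[OF t(1,2)] d'(2)[OF t(1,3)] have "\<bar>t * t * (J u \<bullet> v) - t * t * (J v \<bullet> u)\<bar> \<le> e * (t * t) * (norm v * (norm u + 2 * norm v))
      + e * (t * t) * (norm u * (norm v + 2 * norm u))"
      unfolding abs_le_iff by (simp only:) linarith
    then have "(t * t) * \<bar>J u \<bullet> v - J v \<bullet> u\<bar> \<le> (t * t) * (e * C)"
      unfolding right_diff_distrib[symmetric] abs_mult C_def using t(1)
      by (simp only: abs_of_pos) (simp add: algebra_simps)
    then have "\<bar>J u \<bullet> v - J v \<bullet> u\<bar> \<le> e * C" by (rule mult_left_le_imp_le) (use t(1) in simp)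
    then show ?thesis by simp
  qed
  then have "\<bar>J u \<bullet> v - J v \<bullet> u\<bar> \<le> 0" by (rule le_of_le_add_small)
  then show ?thesis by simp
qed

lemma smooth_convex_derivative_bounds:
  assumes "smooth_convex L \<phi> G" and J: "(G has_derivative J) (at x)"
  shows "0 \<le> J v \<bullet> v" "J v \<bullet> v \<le> L * (norm v)\<^sup>2"
proof -
  interpret J: bounded_linear J using J by (rule has_derivative_bounded_linear)
  have "0 \<le> J v \<bullet> v + e * (norm v)\<^sup>2 \<and> J v \<bullet> v \<le> L * (norm v)\<^sup>2 + e * (norm v)\<^sup>2" if "e > 0" for e
  proof -
    obtain d where d: "d > 0" "\<And>h. norm h < d \<Longrightarrow> norm (G (x + h) - G x - J h) \<le> e * norm h"
      using has_derivative_remainder_bound[OF J \<open>e > 0\<close>] by blast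
    define t where "t = d / (norm v + 1)"
    have v1: "norm v + 1 > 0" by (smt (verit) norm_ge_zero)
    have t: "t > 0" using d(1) v1 by (simp add: t_def)
    have "t * norm v < d" using d(1) v1 by (simp add: t_def field_simps)
    define h where "h = t *\<^sub>R v"
    have hd: "norm h < d" using t \<open>t * norm v < d\<close> by (simp add: h_def)
    \<comment> \<open>Adding the inequalities of \<open>smooth_convex\<close> at x with increment h
      and at \<open>x + h\<close> with increment \<open>- h\<close> cancels the function
      values.\<close>
    have G: "0 \<le> (G (x + h) - G x) \<bullet> h" "(G (x + h) - G x) \<bullet> h \<le> L * (norm h)\<^sup>2"
      using smooth_convexD(2,3)[OF assms(1), of x h] smooth_convexD(2,3)[OF assms(1), of "x + h" "- h"]
      by (auto simp: inner_diff_left)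
    have "\<bar>(G (x + h) - G x - J h) \<bullet> h\<bar> \<le> e * norm h * norm h"
      by (rule order_trans[OF Cauchy_Schwarz_ineq2 mult_right_mono[OF d(2)[OF hd]]]) simp
    then have "\<bar>(G (x + h) - G x) \<bullet> h - J h \<bullet> h\<bar> \<le> e * (norm h)\<^sup>2"
      by (simp add: inner_diff_left power2_eq_square mult.assoc)
    with G have "0 \<le> J h \<bullet> h + e * (norm h)\<^sup>2" "J h \<bullet> h \<le> L * (norm h)\<^sup>2 + e * (norm h)\<^sup>2" by linarith+
    moreover have "J h \<bullet> h = (t * t) * (J v \<bullet> v)" "(norm h)\<^sup>2 = (t * t) * (norm v)\<^sup>2"
      by (simp_all add: h_def J.scaleR power2_eq_square)
    ultimately have "(t * t) * 0 \<le> (t * t) * (J v \<bullet> v + e * (norm v)\<^sup>2)"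
      "(t * t) * (J v \<bullet> v) \<le> (t * t) * (L * (norm v)\<^sup>2 + e * (norm v)\<^sup>2)"
      by (simp_all add: algebra_simps)
    then show ?thesis using t by (metis mult_pos_pos mult_left_le_imp_le)
  qed
  then show "0 \<le> J v \<bullet> v" "J v \<bullet> v \<le> L * (norm v)\<^sup>2" 
    by (blast intro: le_of_le_add_small)+
qed

subsection \<open>The shifted Moreau envelope\<close>

text \<open>Common form of the two envelopes in (P_k): q = Q^T w^k gives f_k and q = - y^k gives
  g_k.\<close>

definition shifted_env :: "real \<Rightarrow> ('a::euclidean_space \<Rightarrow> ereal) \<Rightarrow> 'a \<Rightarrow> 'a \<Rightarrow> real" where
  "shifted_env \<gamma> \<psi> q x = moreau_env (1 / \<gamma>) \<psi> (x - (1 / \<gamma>) *\<^sub>R q) - 1 / (2 * \<gamma>) * (norm q)\<^sup>2"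

definition shifted_grad :: "real \<Rightarrow> ('a::euclidean_space \<Rightarrow> ereal) \<Rightarrow> 'a \<Rightarrow> 'a \<Rightarrow> 'a" where
  "shifted_grad \<gamma> \<psi> q x = \<gamma> *\<^sub>R (x - (1 / \<gamma>) *\<^sub>R q - prox (1 / \<gamma>) \<psi> (x - (1 / \<gamma>) *\<^sub>R q))"

text \<open>The pair \<open>P\<close>, \<open>r\<close> describes the envelope algebraically: its
  gradient is a subgradient of \<psi> at the proximal point \<open>P\<close>, and x is recovered
  from the two. Later estimates compare such representations instead of minimization
  problems.\<close>

lemma shifted_env_repr:
  fixes \<psi> :: "'a::euclidean_space \<Rightarrow> ereal"
  assumes "proper_closed_convex \<psi>" "\<gamma> > 0"
  obtains P r where "exact_subgrad \<psi> P r (shifted_grad \<gamma> \<psi> q x)"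
    "x = (1 / \<gamma>) *\<^sub>R (shifted_grad \<gamma> \<psi> q x + q) + P"
    "shifted_env \<gamma> \<psi> q x =
      1 / (2 * \<gamma>) * (norm (shifted_grad \<gamma> \<psi> q x))\<^sup>2 + r - 1 / (2 * \<gamma>) * (norm q)\<^sup>2"
proof -
  let ?p = "x - (1 / \<gamma>) *\<^sub>R q"
  define P where "P = prox (1 / \<gamma>) \<psi> ?p"
  obtain r where r: "exact_subgrad \<psi> P r ((1 / (1 / \<gamma>)) *\<^sub>R (?p - P))"
    using prox_subgrad[OF assms(1), of "1 / \<gamma>" ?p] assms(2) unfolding P_def by auto
  have s: "shifted_grad \<gamma> \<psi> q x = \<gamma> *\<^sub>R (?p - P)" by (simp add: shifted_grad_def P_def)
  have "moreau_env (1 / \<gamma>) \<psi> ?p = 1 / (2 * (1 / \<gamma>)) * (norm (P - ?p))\<^sup>2 + r"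
    by (rule prox_of_subgrad(2)[OF _ r]) (use assms(2) in simp)
  also have "1 / (2 * (1 / \<gamma>)) * (norm (P - ?p))\<^sup>2 = 1 / (2 * \<gamma>) * (norm (shifted_grad \<gamma> \<psi> q x))\<^sup>2"
    unfolding s using assms(2) by (simp add: norm_minus_commute power_mult_distrib power2_eq_square[of \<gamma>])
  finally have "shifted_env \<gamma> \<psi> q x =
      1 / (2 * \<gamma>) * (norm (shifted_grad \<gamma> \<psi> q x))\<^sup>2 + r - 1 / (2 * \<gamma>) * (norm q)\<^sup>2"
    by (simp add: shifted_env_def)
  moreover have "x = (1 / \<gamma>) *\<^sub>R (shifted_grad \<gamma> \<psi> q x + q) + P"
    unfolding s using assms(2) by (simp add: scaleR_right_distrib)
  moreover have "exact_subgrad \<psi> P r (shifted_grad \<gamma> \<psi> q x)" using r s by simp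
  ultimately show thesis using that by blast
qed

text \<open>With \<delta> and \<open>D\<close> the changes of the gradient and of the proximal
  point, \<open>h = (1 / \<gamma>) *\<^sub>R \<delta> + D\<close>, and the two subgradient
  inequalities confine the change of \<psi> between \<open>s \<bullet> D\<close> and
  \<open>s' \<bullet> D\<close>. The lower one gives convexity; the upper one leaves
  \<open>\<delta> \<bullet> D\<close>, which the expansion of
  \<open>\<gamma> / 2 * (norm h)\<^sup>2\<close> absorbs.\<close>

lemma smooth_convex_shifted_env:
  fixes \<psi> :: "'a::euclidean_space \<Rightarrow> ereal"
  assumes "proper_closed_convex \<psi>" "\<gamma> > 0"
  shows "smooth_convex \<gamma> (shifted_env \<gamma> \<psi> q) (shifted_grad \<gamma> \<psi> q)"
  unfolding smooth_convex_def
proof (intro conjI allI)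
  fix x h :: 'a
  show "0 \<le> \<gamma>" using assms by simp
  define s where "s = shifted_grad \<gamma> \<psi> q x"
  define s' where "s' = shifted_grad \<gamma> \<psi> q (x + h)"
  obtain P r where 1: "exact_subgrad \<psi> P r s" "x = (1 / \<gamma>) *\<^sub>R (s + q) + P"
    "shifted_env \<gamma> \<psi> q x = 1 / (2 * \<gamma>) * (norm s)\<^sup>2 + r - 1 / (2 * \<gamma>) * (norm q)\<^sup>2"
    unfolding s_def using shifted_env_repr[OF assms] by metis
  obtain P' r' where 2: "exact_subgrad \<psi> P' r' s'" "x + h = (1 / \<gamma>) *\<^sub>R (s' + q) + P'"
    "shifted_env \<gamma> \<psi> q (x + h) = 1 / (2 * \<gamma>) * (norm s')\<^sup>2 + r' - 1 / (2 * \<gamma>) * (norm q)\<^sup>2"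
    unfolding s'_def using shifted_env_repr[OF assms] by metis
  define \<delta> where "\<delta> = s' - s"
  define D where "D = P' - P"
  have s': "s' = s + \<delta>" and P': "P' = P + D" by (simp_all add: \<delta>_def D_def)
  have "h = (1 / \<gamma>) *\<^sub>R (s' + q) + P' - ((1 / \<gamma>) *\<^sub>R (s + q) + P)"
    using 1(2) 2(2) by (metis add_diff_cancel_left')
  then have h: "h = (1 / \<gamma>) *\<^sub>R \<delta> + D" by (simp add: s' P' algebra_simps)
  have lo: "s \<bullet> D \<le> r' - r"
    using exact_subgradD(2)[OF 1(1), of P'] exact_subgradD(1)[OF 2(1)] by (simp add: D_def)
  have up: "r' - r \<le> s' \<bullet> D"
    using exact_subgradD(2)[OF 2(1), of P] exact_subgradD(1)[OF 1(1)] by (simp add: D_def inner_diff_right)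
  have diff: "shifted_env \<gamma> \<psi> q (x + h) - shifted_env \<gamma> \<psi> q x - s \<bullet> h
      = (r' - r) - s \<bullet> D + 1 / (2 * \<gamma>) * (norm \<delta>)\<^sup>2"
    unfolding 1(3) 2(3) unfolding s' h power2_norm_eq_inner inner_add_left inner_add_right inner_scaleR_right
    using assms(2) by (simp add: field_simps inner_commute)
  have "0 \<le> 1 / (2 * \<gamma>) * (norm \<delta>)\<^sup>2" using assms(2) by simp
  with diff lo show "shifted_env \<gamma> \<psi> q x + s \<bullet> h \<le> shifted_env \<gamma> \<psi> q (x + h)" by linarith
  have "\<gamma> / 2 * (norm h)\<^sup>2 = 1 / (2 * \<gamma>) * (norm \<delta>)\<^sup>2 + \<delta> \<bullet> D + \<gamma> / 2 * (norm D)\<^sup>2"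
    unfolding h power2_norm_eq_inner inner_add_left inner_add_right inner_scaleR_right inner_scaleR_left
    using assms(2) by (simp add: field_simps inner_commute)
  moreover have "0 \<le> \<gamma> / 2 * (norm D)\<^sup>2" using assms(2) by simp
  moreover have "s' \<bullet> D = s \<bullet> D + \<delta> \<bullet> D" by (simp add: s' inner_add_left)
  ultimately show "shifted_env \<gamma> \<psi> q (x + h) \<le> shifted_env \<gamma> \<psi> q x + s \<bullet> h + \<gamma> / 2 * (norm h)\<^sup>2"
    using diff up by linarith
qed

text \<open>The conjugate of the shifted envelope at t is the conjugate of \<psi> plus
  \<open>1 / (2 * \<gamma>) * (norm (t + q))\<^sup>2\<close>; this is Fenchel-Young for that pair,
  tight at the gradient \<open>s\<close>. The minorant falls short of
  \<open>t \<bullet> P - r\<close> by a multiple of the squared distance from t to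
  \<open>s\<close>.\<close>

lemma shifted_env_fenchel_young:
  fixes \<psi> :: "'a::euclidean_space \<Rightarrow> ereal"
  assumes "proper_closed_convex \<psi>" "\<gamma> > 0"
  shows "ereal (t \<bullet> x - shifted_env \<gamma> \<psi> q x - 1 / (2 * \<gamma>) * (norm (t + q))\<^sup>2) \<le> fenchel_conj \<psi> t"
    and "fenchel_conj \<psi> (shifted_grad \<gamma> \<psi> q x) =
      ereal (shifted_grad \<gamma> \<psi> q x \<bullet> x - shifted_env \<gamma> \<psi> q x
        - 1 / (2 * \<gamma>) * (norm (shifted_grad \<gamma> \<psi> q x + q))\<^sup>2)"
proof -
  define s where "s = shifted_grad \<gamma> \<psi> q x"
  obtain P r where 1: "exact_subgrad \<psi> P r s" "x = (1 / \<gamma>) *\<^sub>R (s + q) + P"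
    "shifted_env \<gamma> \<psi> q x = 1 / (2 * \<gamma>) * (norm s)\<^sup>2 + r - 1 / (2 * \<gamma>) * (norm q)\<^sup>2"
    unfolding s_def using shifted_env_repr[OF assms] by metis
  have eq: "t \<bullet> x - shifted_env \<gamma> \<psi> q x - 1 / (2 * \<gamma>) * (norm (t + q))\<^sup>2
      = (t \<bullet> P - r) - 1 / (2 * \<gamma>) * (norm (t - s))\<^sup>2" for t
    unfolding 1(3) unfolding arg_cong[OF 1(2), of "\<lambda>x. t \<bullet> x"]
    unfolding power2_norm_eq_inner inner_add_left inner_add_right inner_scaleR_right inner_diff_left inner_diff_right
    using assms(2) by (simp add: field_simps inner_commute)
  have "0 \<le> 1 / (2 * \<gamma>) * (norm (t - s))\<^sup>2" using assms(2) by simp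
  then have "ereal (t \<bullet> x - shifted_env \<gamma> \<psi> q x - 1 / (2 * \<gamma>) * (norm (t + q))\<^sup>2) \<le> ereal (t \<bullet> P - r)"
    unfolding eq by simp
  also have "\<dots> \<le> fenchel_conj \<psi> t"
    by (rule fenchel_conj_ge) (rule exact_subgradD(1)[OF 1(1)])
  finally show "ereal (t \<bullet> x - shifted_env \<gamma> \<psi> q x - 1 / (2 * \<gamma>) * (norm (t + q))\<^sup>2) \<le> fenchel_conj \<psi> t" .
  show "fenchel_conj \<psi> (shifted_grad \<gamma> \<psi> q x) =
      ereal (shifted_grad \<gamma> \<psi> q x \<bullet> x - shifted_env \<gamma> \<psi> q x
        - 1 / (2 * \<gamma>) * (norm (shifted_grad \<gamma> \<psi> q x + q))\<^sup>2)"
    unfolding s_def[symmetric] eq using fenchel_conj_of_subgrad[OF 1(1)] by simp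
qed

text \<open>Moreau's decomposition: \<open>P\<close> is a subgradient of the conjugate at
  \<open>s\<close>, and \<open>\<gamma> *\<^sub>R x - q - s = \<gamma> *\<^sub>R P\<close>. For q =
  - y^k it identifies the recovered y with the gradient of g_k at A x.\<close>

lemma prox_fenchel_conj:
  fixes \<psi> :: "'a::euclidean_space \<Rightarrow> ereal"
  assumes "proper_closed_convex \<psi>" "\<gamma> > 0"
  shows "prox \<gamma> (fenchel_conj \<psi>) (\<gamma> *\<^sub>R x - q) = shifted_grad \<gamma> \<psi> q x"
proof -
  define s where "s = shifted_grad \<gamma> \<psi> q x"
  obtain P r where 1: "exact_subgrad \<psi> P r s" "x = (1 / \<gamma>) *\<^sub>R (s + q) + P"
    unfolding s_def using shifted_env_repr[OF assms] by metis
  have "\<gamma> *\<^sub>R x = s + q + \<gamma> *\<^sub>R P"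
    by (subst 1(2)) (use assms(2) in \<open>simp add: scaleR_right_distrib\<close>)
  then have "(1 / \<gamma>) *\<^sub>R (\<gamma> *\<^sub>R x - q - s) = P" using assms(2) by simp
  then have "exact_subgrad (fenchel_conj \<psi>) s (s \<bullet> P - r) ((1 / \<gamma>) *\<^sub>R (\<gamma> *\<^sub>R x - q - s))"
    using fenchel_conj_subgrad[OF 1(1)] by simp
  then show ?thesis using prox_of_subgrad(1)[OF assms(2)] unfolding s_def by blast
qed

lemma shifted_env_coercive:
  fixes \<psi> :: "'a::euclidean_space \<Rightarrow> ereal"
  assumes "proper_closed_convex \<psi>" "coercive \<psi>" "\<gamma> > 0" "R \<ge> 0"
  obtains C where "\<And>x. R * norm x - C \<le> shifted_env \<gamma> \<psi> q x"
proof -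
  obtain c where c: "\<And>u. ereal (R * norm u - c) \<le> \<psi> u"
    using coercive_lower_bound[OF assms(1,2,4)] by blast
  \<comment> \<open>The last summand is the cost of Young's inequality, by which the square of
    \<open>norm s\<close> dominates \<open>R * norm s / \<gamma>\<close>; the two summands with q
    are the effect of the shift.\<close>
  define C where "C = c + 1 / (2 * \<gamma>) * (norm q)\<^sup>2 + R * norm q / \<gamma> + R\<^sup>2 / (2 * \<gamma>)"
  have "R * norm x - C \<le> shifted_env \<gamma> \<psi> q x" for x
  proof -
    define s where "s = shifted_grad \<gamma> \<psi> q x"
    obtain P r where 1: "exact_subgrad \<psi> P r s" "x = (1 / \<gamma>) *\<^sub>R (s + q) + P"
      "shifted_env \<gamma> \<psi> q x = 1 / (2 * \<gamma>) * (norm s)\<^sup>2 + r - 1 / (2 * \<gamma>) * (norm q)\<^sup>2"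
      unfolding s_def using shifted_env_repr[OF assms(1,3)] by metis
    have "R * norm P - c \<le> r" using c[of P] exact_subgradD(1)[OF 1(1)] by simp
    moreover have "norm x \<le> (norm s + norm q) / \<gamma> + norm P"
    proof -
      have "norm x \<le> norm ((1 / \<gamma>) *\<^sub>R (s + q)) + norm P"
        by (subst 1(2)) (rule norm_triangle_ineq)
      also have "norm ((1 / \<gamma>) *\<^sub>R (s + q)) \<le> (norm s + norm q) / \<gamma>"
        using assms(3) norm_triangle_ineq[of s q] by (simp add: divide_right_mono)
      finally show ?thesis by simp
    qed
    then have "R * norm x \<le> R * ((norm s + norm q) / \<gamma> + norm P)"
      using assms(4) by (rule mult_left_mono)
    then have "R * norm x \<le> R * norm s / \<gamma> + R * norm q / \<gamma> + R * norm P"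
      by (simp add: distrib_left add_divide_distrib)
    moreover have "0 \<le> (norm s - R)\<^sup>2 / (2 * \<gamma>)" using assms(3) by simp
    then have "R * norm s / \<gamma> \<le> 1 / (2 * \<gamma>) * (norm s)\<^sup>2 + R\<^sup>2 / (2 * \<gamma>)"
      using assms(3) by (simp add: power2_diff field_simps)
    ultimately show ?thesis unfolding 1(3) C_def by linarith
  qed
  then show thesis using that by blast
qed

section \<open>Generalized Hessians\<close>

text \<open>Symmetry together with 0 \<le> H \<le> L I in the Loewner order. Written through the
  bilinear form, the conditions pass to limits and convex combinations, the two operations that make
  up \<open>clarke_jacobian\<close>.\<close>

definition sym_psd_below :: "real \<Rightarrow> real^'n^'n \<Rightarrow> bool" where
  "sym_psd_below L H \<longleftrightarrow> (\<forall>u v. (H *v u) \<bullet> v = (H *v v) \<bullet> u) \<and>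
     (\<forall>v. 0 \<le> (H *v v) \<bullet> v \<and> (H *v v) \<bullet> v \<le> L * (norm v)\<^sup>2)"

lemma sym_psd_belowD:
  assumes "sym_psd_below L H"
  shows "(H *v u) \<bullet> v = (H *v v) \<bullet> u" "0 \<le> (H *v v) \<bullet> v" "(H *v v) \<bullet> v \<le> L * (norm v)\<^sup>2"
  using assms by (auto simp: sym_psd_below_def)

lemma sym_psd_below_add:
  assumes "sym_psd_below L H" "sym_psd_below L' H'"
  shows "sym_psd_below (L + L') (H + H')"
  unfolding sym_psd_below_def
proof (intro conjI allI)
  fix u v
  show "((H + H') *v u) \<bullet> v = ((H + H') *v v) \<bullet> u"
    by (simp add: matrix_vector_mult_add_rdistrib inner_add_left
        sym_psd_belowD(1)[OF assms(1), of u] sym_psd_belowD(1)[OF assms(2), of u])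
  show "0 \<le> ((H + H') *v v) \<bullet> v" "((H + H') *v v) \<bullet> v \<le> (L + L') * (norm v)\<^sup>2"
    using sym_psd_belowD(2,3)[OF assms(1), of v] sym_psd_belowD(2,3)[OF assms(2), of v]
    by (simp_all add: matrix_vector_mult_add_rdistrib inner_add_left distrib_right)
qed

lemma sym_psd_below_scaleR:
  assumes "sym_psd_below L H" "0 \<le> c"
  shows "sym_psd_below (c * L) (c *\<^sub>R H)"
  using assms unfolding sym_psd_below_def
  by (auto simp: scaleR_matrix_vector_assoc[symmetric] mult.assoc intro: mult_left_mono)

lemma sym_psd_below_mat_1: "sym_psd_below 1 (mat 1)"
  by (simp add: sym_psd_below_def inner_commute power2_norm_eq_inner)

lemma inner_transpose_matrix:
  fixes A :: "real^'n^'m"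
  shows "(transpose A *v u) \<bullet> v = u \<bullet> (A *v v)"
  by (metis dot_lmul_matrix transpose_matrix_vector)

lemma sym_psd_below_congruence:
  fixes A :: "real^'n^'m"
  obtains K where "0 \<le> K" "\<And>L V. 0 \<le> L \<Longrightarrow> sym_psd_below L V \<Longrightarrow> sym_psd_below (L * K) (transpose A ** V ** A)"
proof -
  define K where "K = (onorm ((*v) A))\<^sup>2"
  have "norm (A *v v) \<le> onorm ((*v) A) * norm v" for v
    by (rule onorm) (rule matrix_vector_mul_bounded_linear)
  then have "(norm (A *v v))\<^sup>2 \<le> (onorm ((*v) A) * norm v)\<^sup>2" for v
    by (rule power_mono) simp
  then have K: "(norm (A *v v))\<^sup>2 \<le> K * (norm v)\<^sup>2" for v
    by (simp add: K_def power_mult_distrib)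
  have eq: "((transpose A ** V ** A) *v u) \<bullet> v = (V *v (A *v u)) \<bullet> (A *v v)" for V u v
    unfolding matrix_vector_mul_assoc[symmetric] by (rule inner_transpose_matrix)
  have "sym_psd_below (L * K) (transpose A ** V ** A)" if L: "0 \<le> L" and V: "sym_psd_below L V" for L V
    unfolding sym_psd_below_def eq
  proof (intro conjI allI)
    fix u v
    show "(V *v (A *v u)) \<bullet> (A *v v) = (V *v (A *v v)) \<bullet> (A *v u)" by (rule sym_psd_belowD(1)[OF V])
    show "0 \<le> (V *v (A *v v)) \<bullet> (A *v v)" by (rule sym_psd_belowD(2)[OF V])
    have "(V *v (A *v v)) \<bullet> (A *v v) \<le> L * (norm (A *v v))\<^sup>2" by (rule sym_psd_belowD(3)[OF V])
    also have "\<dots> \<le> L * (K * (norm v)\<^sup>2)" by (rule mult_left_mono[OF K L])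
    finally show "(V *v (A *v v)) \<bullet> (A *v v) \<le> L * K * (norm v)\<^sup>2" by simp
  qed
  moreover have "0 \<le> K" by (simp add: K_def)
  ultimately show thesis using that by blast
qed

lemma tendsto_matrix_vector_mult:
  fixes V :: "nat \<Rightarrow> real^'n^'m"
  assumes "V \<longlonglongrightarrow> W"
  shows "(\<lambda>i. V i *v u) \<longlonglongrightarrow> W *v u"
  by (rule vec_tendstoI)
    (auto simp: matrix_vector_mult_def intro!: tendsto_sum tendsto_mult tendsto_vec_nth assms)

lemma convex_sym_psd_below: "convex {H. sym_psd_below L H}"
proof (rule convexI)
  fix H H' :: "real^'n^'n" and a b :: real
  assume *: "H \<in> {H. sym_psd_below L H}" "H' \<in> {H. sym_psd_below L H}" "0 \<le> a" "0 \<le> b" "a + b = 1"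
  then have "sym_psd_below (a * L + b * L) (a *\<^sub>R H + b *\<^sub>R H')"
    by (intro sym_psd_below_add sym_psd_below_scaleR) auto
  moreover have "a * L + b * L = L" using \<open>a + b = 1\<close> by (simp flip: distrib_right)
  ultimately show "a *\<^sub>R H + b *\<^sub>R H' \<in> {H. sym_psd_below L H}" by simp
qed

lemma clarke_jacobian_sym_psd_below:
  fixes \<phi> :: "real^'n \<Rightarrow> real"
  assumes "smooth_convex L \<phi> G" "U \<in> clarke_jacobian G x"
  shows "sym_psd_below L U"
proof -
  have "{V. \<exists>u. (\<forall>i::nat. G differentiable (at (u i))) \<and> u \<longlonglongrightarrow> x \<and>
             (\<lambda>i. jacobian G (at (u i))) \<longlonglongrightarrow> V} \<subseteq> {H. sym_psd_below L H}"
  proof safe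
    fix V u
    assume u: "\<forall>i::nat. G differentiable (at (u i))" and lim: "(\<lambda>i. jacobian G (at (u i))) \<longlonglongrightarrow> V"
    let ?J = "\<lambda>i. jacobian G (at (u i))"
    have J: "(G has_derivative (\<lambda>h. ?J i *v h)) (at (u i))" for i
      using u jacobian_works by blast
    have lim': "(\<lambda>i. (?J i *v v) \<bullet> w) \<longlonglongrightarrow> (V *v v) \<bullet> w" for v w
      by (intro tendsto_inner tendsto_matrix_vector_mult lim tendsto_const)
    show "sym_psd_below L V"
      unfolding sym_psd_below_def
    proof (intro conjI allI)
      fix v w
      have "(?J i *v v) \<bullet> w = (?J i *v w) \<bullet> v" for i
        by (rule gradient_derivative_symmetric[OF smooth_convex_gderiv[OF assms(1)] J])
      then show "(V *v v) \<bullet> w = (V *v w) \<bullet> v"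
        using lim'[of v w] lim'[of w v] by (simp add: LIMSEQ_unique)
      show "0 \<le> (V *v v) \<bullet> v"
        by (rule LIMSEQ_le_const[OF lim']) (use smooth_convex_derivative_bounds(1)[OF assms(1) J] in blast)
      show "(V *v v) \<bullet> v \<le> L * (norm v)\<^sup>2"
        by (rule LIMSEQ_le_const2[OF lim']) (use smooth_convex_derivative_bounds(2)[OF assms(1) J] in blast)
    qed
  qed
  then have "convex hull {V. \<exists>u. (\<forall>i::nat. G differentiable (at (u i))) \<and> u \<longlonglongrightarrow> x \<and>
             (\<lambda>i. jacobian G (at (u i))) \<longlonglongrightarrow> V} \<subseteq> {H. sym_psd_below L H}"
    by (intro hull_minimal convex_sym_psd_below)
  then show ?thesis using assms(2) unfolding clarke_jacobian_def by blast
qed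

section \<open>Conjugate gradients\<close>

definition cg_residual :: "real^'n^'n \<Rightarrow> real^'n \<Rightarrow> nat \<Rightarrow> real^'n" where
  "cg_residual K b i = fst (snd (cg_state K b i))"

definition cg_search :: "real^'n^'n \<Rightarrow> real^'n \<Rightarrow> nat \<Rightarrow> real^'n" where
  "cg_search K b i = snd (snd (cg_state K b i))"

definition cg_step :: "real^'n^'n \<Rightarrow> real^'n \<Rightarrow> nat \<Rightarrow> real" where
  "cg_step K b i = (cg_residual K b i \<bullet> cg_residual K b i) / (cg_search K b i \<bullet> (K *v cg_search K b i))"

lemma cg_0: "cg_iterate K b 0 = 0" "cg_residual K b 0 = b" "cg_search K b 0 = b"
  by (simp_all add: cg_iterate_def cg_residual_def cg_search_def)

lemma cg_Suc:
  "cg_iterate K b (Suc i) = cg_iterate K b i + cg_step K b i *\<^sub>R cg_search K b i"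
  "cg_residual K b (Suc i) = cg_residual K b i - cg_step K b i *\<^sub>R (K *v cg_search K b i)"
  "cg_search K b (Suc i) = cg_residual K b (Suc i) +
     ((cg_residual K b (Suc i) \<bullet> cg_residual K b (Suc i)) / (cg_residual K b i \<bullet> cg_residual K b i)) *\<^sub>R cg_search K b i"
  by (simp_all add: cg_iterate_def cg_residual_def cg_search_def cg_step_def Let_def split: prod.splits)

lemma cg_iterate_zero_rhs: "cg_iterate K 0 i = 0"
proof -
  have "cg_residual K 0 i = 0 \<and> cg_search K 0 i = 0 \<and> cg_iterate K 0 i = 0"
    by (induction i) (simp_all add: cg_0 cg_Suc cg_step_def)
  then show ?thesis by simp
qed

lemma cg_search_zero:
  assumes "cg_residual K b i = 0"
  shows "cg_search K b i = 0"
  using assms by (cases i) (simp_all add: cg_0 cg_Suc(3))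

context
  fixes K :: "real^'n^'n" and b :: "real^'n"
  assumes K_sym: "\<And>u v. (K *v u) \<bullet> v = (K *v v) \<bullet> u"
    and K_pos: "\<And>v. v \<noteq> 0 \<Longrightarrow> 0 < (K *v v) \<bullet> v"
begin

private abbreviation r where "r \<equiv> cg_residual K b"
private abbreviation p where "p \<equiv> cg_search K b"
private abbreviation a where "a \<equiv> cg_step K b"

text \<open>Exact minimization along \<open>p i\<close> makes the next residual orthogonal to it,
  whence \<open>r i \<bullet> p i = r i \<bullet> r i\<close> for all i. In this division-free form
  the step formula survives termination, since a vanishing direction forces a vanishing
  residual.\<close>

lemma cg_step_eq: "a i * (p i \<bullet> (K *v p i)) = r i \<bullet> r i"
proof -
  have step: "a i * (p i \<bullet> (K *v p i)) = r i \<bullet> r i" if "r i \<bullet> p i = r i \<bullet> r i" for i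
  proof (cases "p i = 0")
    case True
    then show ?thesis using that by simp
  next
    case False
    then show ?thesis using K_pos[OF False] by (simp add: cg_step_def inner_commute)
  qed
  have "r i \<bullet> p i = r i \<bullet> r i"
  proof (induction i)
    case (Suc i)
    have "r (Suc i) \<bullet> p i = 0"
      using step[OF Suc] Suc by (simp add: cg_Suc(2) inner_diff_left inner_commute[of "K *v p i"])
    then show ?case by (simp add: cg_Suc(3) inner_add_right)
  qed (simp add: cg_0)
  then show "a i * (p i \<bullet> (K *v p i)) = r i \<bullet> r i" by (rule step)
qed

lemma cg_step_nonneg: "0 \<le> a i"
proof (cases "p i = 0")
  case False
  then show ?thesis using K_pos[OF False] by (simp add: cg_step_def inner_commute)
qed (simp add: cg_step_def)

text \<open>Orthogonality of residuals and conjugacy of directions feed each other and so share one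
  induction.\<close>

lemma cg_orthogonal: "i < j \<Longrightarrow> r i \<bullet> r j = 0 \<and> p i \<bullet> (K *v p j) = 0"
proof (induction j arbitrary: i)
  case (Suc n)
  \<comment> \<open>A residual is a combination of the current and the previous direction, and both
    are conjugate to \<open>p n\<close> by induction.\<close>
  have conj_r: "r i \<bullet> (K *v p n) = 0" if "i < n" for i
  proof (cases i)
    case 0
    then show ?thesis using Suc.IH[OF that] by (simp add: cg_0)
  next
    case (Suc l)
    have "r i = p i - ((r i \<bullet> r i) / (r l \<bullet> r l)) *\<^sub>R p l"
      unfolding Suc by (simp add: cg_Suc(3))
    moreover have "p i \<bullet> (K *v p n) = 0" "p l \<bullet> (K *v p n) = 0"
      using Suc.IH[of i] Suc.IH[of l] that Suc by auto
    ultimately show ?thesis by (metis inner_diff_left inner_scaleR_left mult_zero_right diff_zero)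
  qed
  have conj_rn: "r n \<bullet> (K *v p n) = p n \<bullet> (K *v p n)"
  proof (cases n)
    case 0
    then show ?thesis by (simp add: cg_0)
  next
    case (Suc l)
    have "p n = r n + ((r n \<bullet> r n) / (r l \<bullet> r l)) *\<^sub>R p l"
      unfolding Suc by (simp add: cg_Suc(3))
    moreover have "p l \<bullet> (K *v p n) = 0" using Suc.IH[of l] Suc by auto
    ultimately show ?thesis by (metis inner_add_left inner_scaleR_left mult_zero_right add_0_right)
  qed
  have rr: "r i \<bullet> r (Suc n) = 0" if "i < Suc n" for i
  proof (cases "i = n")
    case True
    then show ?thesis using cg_step_eq[of n] conj_rn by (simp add: cg_Suc(2) inner_diff_right)
  next
    case False
    then show ?thesis using Suc.IH[of i] conj_r[of i] that by (simp add: cg_Suc(2) inner_diff_right)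
  qed
  have Kp: "a i *\<^sub>R (K *v p i) = r i - r (Suc i)" for i by (simp add: cg_Suc(2))
  have "p i \<bullet> (K *v p (Suc n)) = 0"
  proof (cases "r i = 0")
    case True
    then show ?thesis by (simp add: cg_search_zero)
  next
    case False
    then have a: "a i \<noteq> 0" using cg_step_eq[of i] by auto
    define c where "c = (r (Suc n) \<bullet> r (Suc n)) / (r n \<bullet> r n)"
    have ps: "p (Suc n) = r (Suc n) + c *\<^sub>R p n" by (simp add: cg_Suc(3) c_def)
    have "a i * (p i \<bullet> (K *v p (Suc n))) = (a i *\<^sub>R (K *v p i)) \<bullet> p (Suc n)"
      by (metis K_sym inner_commute inner_scaleR_left)
    also have "\<dots> = (r i - r (Suc i)) \<bullet> r (Suc n) + c * (a i * (p i \<bullet> (K *v p n)))"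
      unfolding Kp[symmetric] ps
      by (simp add: inner_add_right K_sym[of "p i" "p n"] inner_commute[of "p i"])
    \<comment> \<open>For \<open>i = n\<close> the residual difference contributes minus the square
      of \<open>r (Suc n)\<close>, and the choice of \<open>c\<close> contributes plus the same
      square. For \<open>i < n\<close> every term vanishes.\<close>
    also have "\<dots> = 0"
    proof (cases "i = n")
      case True
      then show ?thesis using False cg_step_eq[of n] rr[of n]
        by (simp add: c_def inner_diff_left)
    next
      case False
      then show ?thesis using Suc.IH[of i] Suc.prems rr[of i] rr[of "Suc i"] by (simp add: inner_diff_left)
    qed
    finally show ?thesis using a by simp
  qed
  then show ?case using rr Suc.prems by blast
qed simp

text \<open>\<open>b\<close> is the initial residual, hence orthogonal to all later ones. Only the
  multiple of the old direction contributes, and its coefficient turns the old squared residual into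
  the new one.\<close>

lemma cg_rhs_inner_search: "b \<bullet> p i = r i \<bullet> r i"
proof (induction i)
  case (Suc i)
  have "b \<bullet> r (Suc i) = 0" using cg_orthogonal[of 0 "Suc i"] by (simp add: cg_0)
  then show ?case using Suc
    by (cases "r i = 0") (simp_all add: cg_Suc(3) inner_add_right cg_search_zero cg_Suc(2))
qed (simp add: cg_0)

text \<open>Each step adds \<open>a n * (r n \<bullet> r n) \<ge> 0\<close> to the inner product of
  \<open>b\<close> with the iterate, so the first iterate is the worst case. That one is the exact
  line minimization along \<open>b\<close>, where the inner product is explicit.\<close>

lemma cg_iterate_descent:
  assumes "1 \<le> i" and M: "(K *v b) \<bullet> b \<le> M * (norm b)\<^sup>2"
  shows "(norm b)\<^sup>2 \<le> M * (b \<bullet> cg_iterate K b i)"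
proof (cases "b = 0")
  case False
  have "b \<bullet> cg_iterate K b 1 \<le> b \<bullet> cg_iterate K b i"
    using assms(1)
  proof (induction i rule: dec_induct)
    case (step n)
    have "b \<bullet> cg_iterate K b (Suc n) = b \<bullet> cg_iterate K b n + a n * (r n \<bullet> r n)"
      by (simp add: cg_Suc(1) inner_add_right cg_rhs_inner_search)
    moreover have "0 \<le> a n * (r n \<bullet> r n)" by (intro mult_nonneg_nonneg cg_step_nonneg) simp
    ultimately show ?case using step by linarith
  qed simp
  moreover have b1: "b \<bullet> cg_iterate K b 1 = (norm b)\<^sup>2 * (norm b)\<^sup>2 / ((K *v b) \<bullet> b)"
    by (simp add: cg_Suc(1) cg_0 cg_step_def power2_norm_eq_inner inner_commute)
  have pos: "0 < (K *v b) \<bullet> b" "0 < (norm b)\<^sup>2" using K_pos[OF False] False by auto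
  have "(norm b)\<^sup>2 * ((K *v b) \<bullet> b) \<le> (norm b)\<^sup>2 * (M * (norm b)\<^sup>2)"
    using M by (intro mult_left_mono) auto
  then have "(norm b)\<^sup>2 \<le> M * (b \<bullet> cg_iterate K b 1)"
    unfolding b1 using pos by (simp add: field_simps)
  moreover have "0 < M * (norm b)\<^sup>2" using pos(1) M by linarith
  then have "0 \<le> M" using pos(2) by (simp add: zero_less_mult_iff)
  ultimately show ?thesis by (meson mult_left_mono order_trans)
qed simp

end

section \<open>Global convergence of the inexact Newton method\<close>

text \<open>The descent part is \<open>cg_iterate_descent\<close>. For the length, the shift gives
  \<theta> |d| \<le> |K d|, and the residual test bounds |K d| by
  \<open>norm g * (1 + N powr \<tau>)\<close>; the factor \<open>norm g\<close> contained in
  \<theta> cancels, so the bound does not blow up as the gradient vanishes.\<close>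

lemma newton_direction_bounds:
  assumes nd: "newton_direction \<tau> \<tau>1 \<tau>2 \<Psi> Hess x d"
    and Hess: "\<And>H. H \<in> Hess x \<Longrightarrow> sym_psd_below L H" and "0 \<le> L"
    and \<tau>: "0 < \<tau>" "0 < \<tau>1" "0 < \<tau>2" "\<tau>2 < 1"
    and N: "norm (nabla \<Psi> x) \<le> N"
  shows "(norm (nabla \<Psi> x))\<^sup>2 \<le> (L + \<tau>1 * N) * - (nabla \<Psi> x \<bullet> d)"
    and "norm d \<le> (1 + N powr \<tau>) / \<tau>1"
proof -
  define g where "g = nabla \<Psi> x"
  define \<theta> where "\<theta> = \<tau>1 * norm g"
  obtain H i where H: "H \<in> Hess x" and i: "1 \<le> i"
    and d: "d = cg_iterate (H + \<theta> *\<^sub>R mat 1) (- g) i"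
    and res: "norm ((H + \<theta> *\<^sub>R mat 1) *v d + g) \<le> \<tau>2 * norm g powr (1 + \<tau>)"
    using nd unfolding newton_direction_def Let_def g_def \<theta>_def by blast
  let ?K = "H + \<theta> *\<^sub>R mat 1"
  have "(norm g)\<^sup>2 \<le> (L + \<tau>1 * N) * - (g \<bullet> d) \<and> norm d \<le> (1 + N powr \<tau>) / \<tau>1"
  proof (cases "g = 0")
    case True
    then show ?thesis using d \<tau> by (simp add: cg_iterate_zero_rhs)
  next
    case False
    have \<theta>: "0 < \<theta>" "\<theta> \<le> \<tau>1 * N" using False \<tau> N by (auto simp: \<theta>_def g_def)
    note Hp = Hess[OF H]
    have K: "sym_psd_below (L + \<theta> * 1) ?K"
      using \<theta> by (intro sym_psd_below_add sym_psd_below_scaleR sym_psd_below_mat_1 Hp) simp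
    have Klow: "\<theta> * (norm v)\<^sup>2 \<le> (?K *v v) \<bullet> v" for v
      using sym_psd_belowD(2)[OF Hp, of v]
      by (simp add: matrix_vector_mult_add_rdistrib scaleR_matrix_vector_assoc[symmetric] inner_add_left power2_norm_eq_inner)
    have Kpos: "0 < (?K *v v) \<bullet> v" if "v \<noteq> 0" for v
      by (rule less_le_trans[OF _ Klow]) (use that \<theta> in simp)
    have "(norm (- g))\<^sup>2 \<le> (L + \<theta> * 1) * ((- g) \<bullet> d)"
      unfolding d by (rule cg_iterate_descent[OF sym_psd_belowD(1)[OF K] Kpos i sym_psd_belowD(3)[OF K]])
    then have 1: "(norm g)\<^sup>2 \<le> (L + \<theta>) * - (g \<bullet> d)" by simp
    have "0 < (norm g)\<^sup>2" using False by simp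
    with 1 have "0 < (L + \<theta>) * - (g \<bullet> d)" by linarith
    moreover have "0 < L + \<theta>" using \<open>0 \<le> L\<close> \<theta>(1) by simp
    ultimately have "0 \<le> - (g \<bullet> d)" by (meson less_imp_le zero_less_mult_pos)
    then have "(L + \<theta>) * - (g \<bullet> d) \<le> (L + \<tau>1 * N) * - (g \<bullet> d)"
      using \<theta>(2) by (intro mult_right_mono) auto
    with 1 have 2: "(norm g)\<^sup>2 \<le> (L + \<tau>1 * N) * - (g \<bullet> d)" by linarith
    have "norm (?K *v d) \<le> norm (?K *v d + g) + norm g"
      using norm_triangle_ineq4[of "?K *v d + g" g] by simp
    also have "\<dots> \<le> \<tau>2 * norm g powr (1 + \<tau>) + norm g" using res by simp
    also have "norm g powr (1 + \<tau>) = norm g * norm g powr \<tau>"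
      using False by (simp add: powr_add)
    also have "\<tau>2 * (norm g * norm g powr \<tau>) \<le> 1 * (norm g * norm g powr \<tau>)"
      using \<tau> by (intro mult_right_mono) auto
    also have "1 * (norm g * norm g powr \<tau>) \<le> norm g * N powr \<tau>"
      using N \<tau> by (simp add: g_def mult_left_mono powr_mono2)
    finally have Kd: "norm (?K *v d) \<le> norm g * (1 + N powr \<tau>)" by (simp add: algebra_simps)
    have "\<tau>1 * norm d \<le> 1 + N powr \<tau>"
    proof (cases "d = 0")
      case False
      have "\<theta> * norm d * norm d \<le> norm (?K *v d) * norm d"
        using order_trans[OF Klow[of d] norm_cauchy_schwarz] by (simp add: power2_eq_square)
      then have "\<theta> * norm d \<le> norm (?K *v d)" using False by simp
      with Kd have "norm g * (\<tau>1 * norm d) \<le> norm g * (1 + N powr \<tau>)"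
        by (simp add: \<theta>_def algebra_simps)
      then show ?thesis using \<open>g \<noteq> 0\<close> by simp
    qed (use \<tau> in simp)
    then have "norm d \<le> (1 + N powr \<tau>) / \<tau>1" using \<tau> by (simp add: field_simps)
    with 2 show ?thesis by simp
  qed
  then show "(norm (nabla \<Psi> x))\<^sup>2 \<le> (L + \<tau>1 * N) * - (nabla \<Psi> x \<bullet> d)"
    and "norm d \<le> (1 + N powr \<tau>) / \<tau>1" by (simp_all add: g_def)
qed

section \<open>Armijo line search\<close>

lemma line_search_decrease:
  assumes "smooth_convex L \<phi> G" "0 < \<beta>" "line_search_step \<beta> \<zeta> \<phi> x d \<alpha>"
  shows "0 < \<alpha>" "\<phi> (x + \<alpha> *\<^sub>R d) \<le> \<phi> x + \<zeta> * \<alpha> * (G x \<bullet> d)"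
  using assms(2,3) unfolding line_search_step_def Let_def smooth_convex_nabla[OF assms(1)] by auto

text \<open>Either the full step is accepted, or the trial before the accepted one failed. Failure,
  set against the quadratic upper bound, makes that trial step at least a multiple of the descent
  \<open>- (G x \<bullet> d)\<close>; one factor \<beta> leads to \<alpha>.\<close>

lemma line_search_step_size:
  assumes "smooth_convex L \<phi> G" "0 < L" "0 < \<beta>" "\<beta> < 1" "\<zeta> < 1"
    and ls: "line_search_step \<beta> \<zeta> \<phi> x d \<alpha>"
    and D: "norm d \<le> D" "0 < D" and desc: "0 \<le> - (G x \<bullet> d)"
  shows "min 1 (2 * \<beta> * (1 - \<zeta>) / (L * D\<^sup>2) * - (G x \<bullet> d)) \<le> \<alpha>"
proof -
  obtain q where first: "\<And>r. r < q \<Longrightarrow> \<not> \<phi> (x + \<beta> ^ r *\<^sub>R d) \<le> \<phi> x + \<zeta> * \<beta> ^ r * (G x \<bullet> d)"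
    and \<alpha>: "\<alpha> = \<beta> ^ q"
    using ls unfolding line_search_step_def Let_def smooth_convex_nabla[OF assms(1)] by blast
  show ?thesis
  proof (cases q)
    case 0
    then show ?thesis by (simp add: \<alpha>)
  next
    case (Suc r)
    define t where "t = \<beta> ^ r"
    have t: "0 < t" "\<alpha> = \<beta> * t" using assms(3) by (auto simp: t_def \<alpha> Suc)
    have "\<phi> x + \<zeta> * t * (G x \<bullet> d) < \<phi> (x + t *\<^sub>R d)" using first[of r] Suc by (simp add: t_def)
    also have "\<dots> \<le> \<phi> x + G x \<bullet> (t *\<^sub>R d) + L / 2 * (norm (t *\<^sub>R d))\<^sup>2"
      by (rule smooth_convexD(3)[OF assms(1)])
    finally have "t * ((1 - \<zeta>) * - (G x \<bullet> d)) < t * (L / 2 * (t * (norm d)\<^sup>2))"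
      by (simp add: algebra_simps power2_eq_square)
    then have "(1 - \<zeta>) * - (G x \<bullet> d) < L / 2 * (t * (norm d)\<^sup>2)"
      using t(1) by (simp only: mult_less_cancel_left_pos)
    also have "\<dots> \<le> L / 2 * (t * D\<^sup>2)"
      using assms(2) t D by (intro mult_left_mono power_mono) auto
    finally have "(1 - \<zeta>) * - (G x \<bullet> d) \<le> L / 2 * (t * D\<^sup>2)" by simp
    then have "\<beta> * ((1 - \<zeta>) * - (G x \<bullet> d)) \<le> \<beta> * (L / 2 * (t * D\<^sup>2))"
      using assms(3) by (intro mult_left_mono) auto
    moreover have "0 < L * D\<^sup>2" using assms(2) D by simp
    ultimately have "2 * \<beta> * (1 - \<zeta>) / (L * D\<^sup>2) * - (G x \<bullet> d) \<le> \<alpha>"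
      unfolding t(2) by (simp add: field_simps)
    then show ?thesis by simp
  qed
qed

text \<open>The values decrease and are bounded below, so the decrements tend to 0. A decrement is
  at least \<zeta> times the minimum of \<open>\<delta> j\<close> and
  \<open>\<kappa> * (\<delta> j)\<^sup>2\<close>, according to which alternative of the step size
  bound applies.\<close>

lemma armijo_gradient_tendsto_zero:
  assumes sc: "smooth_convex L \<phi> G" and "0 < L" "0 < \<beta>" "\<beta> < 1" "0 < \<zeta>" "\<zeta> < 1"
    and ls: "\<And>j. line_search_step \<beta> \<zeta> \<phi> (x j) (d j) (\<alpha> j)"
    and step: "\<And>j. x (Suc j) = x j + \<alpha> j *\<^sub>R d j"
    and low: "\<And>y. m \<le> \<phi> y"
    and D: "\<And>j. norm (d j) \<le> D" "0 < D"
    and desc: "\<And>j. (norm (G (x j)))\<^sup>2 \<le> c * - (G (x j) \<bullet> d j)" "0 < c"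
  shows "(\<lambda>j. G (x j)) \<longlonglongrightarrow> 0"
proof -
  define \<delta> where "\<delta> j = - (G (x j) \<bullet> d j)" for j
  have \<delta>0: "0 \<le> \<delta> j" for j
  proof -
    have "0 \<le> c * \<delta> j" using order_trans[OF zero_le_power2 desc(1)[of j]] by (simp add: \<delta>_def)
    then show ?thesis using desc(2) by (simp add: zero_le_mult_iff)
  qed
  define \<kappa> where "\<kappa> = 2 * \<beta> * (1 - \<zeta>) / (L * D\<^sup>2)"
  have \<kappa>: "0 < \<kappa>" using assms by (simp add: \<kappa>_def)
  have \<alpha>: "min 1 (\<kappa> * \<delta> j) \<le> \<alpha> j" for j
    using line_search_step_size[OF sc \<open>0 < L\<close> \<open>0 < \<beta>\<close> \<open>\<beta> < 1\<close> \<open>\<zeta> < 1\<close> ls D \<delta>0[unfolded \<delta>_def], of j]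
    by (simp add: \<delta>_def \<kappa>_def)
  have dec: "\<phi> (x (Suc j)) \<le> \<phi> (x j) - \<zeta> * (\<alpha> j * \<delta> j)" for j
    using line_search_decrease(2)[OF sc \<open>0 < \<beta>\<close> ls, of j] by (simp add: step \<delta>_def)
  have \<delta>\<alpha>: "min (\<delta> j) (\<kappa> * (\<delta> j)\<^sup>2) \<le> \<alpha> j * \<delta> j" for j
  proof -
    have "min 1 (\<kappa> * \<delta> j) * \<delta> j \<le> \<alpha> j * \<delta> j" by (rule mult_right_mono[OF \<alpha> \<delta>0])
    then show ?thesis using \<delta>0[of j] by (simp add: min_def power2_eq_square mult.assoc split: if_splits)
  qed
  have nonneg: "0 \<le> min (\<delta> j) (\<kappa> * (\<delta> j)\<^sup>2)" for j using \<delta>0 \<kappa> by simp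
  have dec': "\<zeta> * min (\<delta> j) (\<kappa> * (\<delta> j)\<^sup>2) \<le> \<phi> (x j) - \<phi> (x (Suc j))" for j
    using dec[of j] mult_left_mono[OF \<delta>\<alpha>[of j] less_imp_le[OF \<open>0 < \<zeta>\<close>]] by linarith
  have "0 \<le> \<zeta> * min (\<delta> j) (\<kappa> * (\<delta> j)\<^sup>2)" for j
    by (rule mult_nonneg_nonneg[OF less_imp_le[OF \<open>0 < \<zeta>\<close>] nonneg])
  then have "\<phi> (x (Suc j)) \<le> \<phi> (x j)" for j using order_trans[OF _ dec', of 0 j] by simp
  then have "decseq (\<lambda>j. \<phi> (x j))" by (rule decseq_SucI)
  then obtain l where "(\<lambda>j. \<phi> (x j)) \<longlonglongrightarrow> l"
    using decseq_convergent[of "\<lambda>j. \<phi> (x j)" m] low by blast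
  then have "(\<lambda>j. \<phi> (x j) - \<phi> (x (Suc j))) \<longlonglongrightarrow> l - l"
    by (intro tendsto_diff LIMSEQ_Suc)
  then have "(\<lambda>j. (\<phi> (x j) - \<phi> (x (Suc j))) / \<zeta>) \<longlonglongrightarrow> (l - l) / \<zeta>"
    using \<open>0 < \<zeta>\<close> by (intro tendsto_divide tendsto_const) auto
  then have lim0: "(\<lambda>j. (\<phi> (x j) - \<phi> (x (Suc j))) / \<zeta>) \<longlonglongrightarrow> 0" by simp
  have "(\<lambda>j. min (\<delta> j) (\<kappa> * (\<delta> j)\<^sup>2)) \<longlonglongrightarrow> 0"
    by (rule tendsto_sandwich[OF _ _ tendsto_const lim0])
      (use nonneg dec' \<open>0 < \<zeta>\<close> in \<open>auto simp: pos_le_divide_eq mult.commute intro!: always_eventually\<close>)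
  have "\<delta> \<longlonglongrightarrow> 0"
  proof (rule LIMSEQ_I)
    fix e :: real assume "0 < e"
    \<comment> \<open>The map from t to the minimum of t and \<kappa> t^2 is increasing for t \<ge>
      0, so its value at \<open>e\<close> is the threshold that keeps \<open>\<delta> j\<close>
      below \<open>e\<close>.\<close>
    then have "0 < min e (\<kappa> * e\<^sup>2)" using \<kappa> by simp
    with \<open>(\<lambda>j. min (\<delta> j) (\<kappa> * (\<delta> j)\<^sup>2)) \<longlonglongrightarrow> 0\<close>
    obtain n where n: "\<And>j. n \<le> j \<Longrightarrow> norm (min (\<delta> j) (\<kappa> * (\<delta> j)\<^sup>2) - 0) < min e (\<kappa> * e\<^sup>2)"
      by (blast dest: LIMSEQ_D)
    have "norm (\<delta> j - 0) < e" if "n \<le> j" for j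
    proof (rule ccontr)
      assume "\<not> ?thesis"
      then have "e \<le> \<delta> j" using \<delta>0[of j] by simp
      moreover from this have "\<kappa> * e\<^sup>2 \<le> \<kappa> * (\<delta> j)\<^sup>2"
        using \<kappa> \<open>0 < e\<close> by (intro mult_left_mono power_mono) auto
      ultimately have "min e (\<kappa> * e\<^sup>2) \<le> min (\<delta> j) (\<kappa> * (\<delta> j)\<^sup>2)" by linarith
      moreover have "min (\<delta> j) (\<kappa> * (\<delta> j)\<^sup>2) < min e (\<kappa> * e\<^sup>2)"
        using n[OF that] nonneg[of j] by (simp only: diff_zero real_norm_def abs_of_nonneg)
      ultimately show False by linarith
    qed
    then show "\<exists>n. \<forall>j\<ge>n. norm (\<delta> j - 0) < e" by blast
  qed
  then have "(\<lambda>j. c * \<delta> j) \<longlonglongrightarrow> c * 0" by (intro tendsto_mult tendsto_const)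
  then have c0: "(\<lambda>j. c * \<delta> j) \<longlonglongrightarrow> 0" by simp
  have "(\<lambda>j. (norm (G (x j)))\<^sup>2) \<longlonglongrightarrow> 0"
    by (rule tendsto_sandwich[OF _ _ tendsto_const c0]) (use desc(1) in \<open>simp_all add: \<delta>_def\<close>)
  then have "(\<lambda>j. norm (G (x j))) \<longlonglongrightarrow> 0"
    using tendsto_real_sqrt by fastforce
  then show ?thesis by (simp only: tendsto_norm_zero_iff)
qed

section \<open>The subproblems\<close>

lemma adjoint_Qmap:
  "adjoint (Qmap A B) w = transpose A *v fst w + transpose B *v snd w"
proof -
  have "adjoint (Qmap A B) = (\<lambda>w. transpose A *v fst w + transpose B *v snd w)"
    by (rule adjoint_unique)
      (simp add: Qmap_def inner_prod_def inner_add_right inner_commute[of "A *v _"] inner_commute[of "B *v _"]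
        inner_transpose_matrix[symmetric] inner_commute[of _ "transpose _ *v _"] del: transpose_matrix_vector)
  then show ?thesis by simp
qed

lemma adjoint_Qmap_diff: "adjoint (Qmap A B) (v - w) = adjoint (Qmap A B) v - adjoint (Qmap A B) w"
  by (simp add: adjoint_Qmap matrix_vector_mult_diff_distrib del: transpose_matrix_vector)

lemma adjoint_Qmap_inner: "adjoint (Qmap A B) w \<bullet> x = fst w \<bullet> (A *v x) + snd w \<bullet> (B *v x)"
  by (simp add: adjoint_Qmap inner_add_left inner_transpose_matrix del: transpose_matrix_vector)

text \<open>The first square completes the Fenchel-Young relation of f_k; the second splits into a
  y-part for g_k and a z-part for h_k.\<close>

lemma sqnorm_M_eq: "sqnorm_M A B w = (norm (adjoint (Qmap A B) w))\<^sup>2 + (norm w)\<^sup>2"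
proof -
  have "w \<bullet> Qmap A B x = adjoint (Qmap A B) w \<bullet> x" for x
    by (simp add: adjoint_Qmap_inner) (simp add: Qmap_def inner_prod_def)
  then show ?thesis
    by (simp add: sqnorm_M_def Mmap_def inner_add_right power2_norm_eq_inner)
qed

lemma power2_norm_prod: "(norm (w :: 'a::real_inner \<times> 'b::real_inner))\<^sup>2 = (norm (fst w))\<^sup>2 + (norm (snd w))\<^sup>2"
  by (simp add: power2_norm_eq_inner inner_prod_def)

lemma f_k_eq: "f_k f A B \<gamma> wk = shifted_env \<gamma> f (adjoint (Qmap A B) wk)"
  by (simp add: fun_eq_iff f_k_def shifted_env_def)

lemma g_k_eq: "g_k g \<gamma> wk = shifted_env \<gamma> g (- fst wk)"
  by (simp add: fun_eq_iff g_k_def shifted_env_def)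

lemma restr_vec_add: "restr_vec T (u + v) = restr_vec T u + restr_vec T v"
  by (simp add: restr_vec_def vec_eq_iff)

lemma restr_vec_scaleR: "restr_vec T (c *\<^sub>R u) = c *\<^sub>R restr_vec T u"
  by (simp add: restr_vec_def vec_eq_iff)

lemma inner_restr_vec: "restr_vec T u \<bullet> restr_vec T v = restr_vec T u \<bullet> v"
  by (auto simp: restr_vec_def inner_vec_def intro!: sum.cong)

lemma restr_vec_id: "(\<And>i. i \<notin> T \<Longrightarrow> z $ i = 0) \<Longrightarrow> restr_vec T z = z"
  by (auto simp: restr_vec_def vec_eq_iff)

lemma norm_restr_vec_le: "norm (restr_vec T u) \<le> norm u"
  by (rule norm_le_componentwise_cart) (simp add: restr_vec_def)

lemma smooth_convex_h_k:
  assumes "\<gamma> > 0"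
  shows "smooth_convex \<gamma> (h_k \<gamma> wk T) (\<lambda>v. restr_vec T (snd wk + \<gamma> *\<^sub>R v))"
  unfolding smooth_convex_def
proof (intro conjI allI)
  fix v h
  show "0 \<le> \<gamma>" using assms by simp
  let ?c = "restr_vec T (v + (1 / \<gamma>) *\<^sub>R snd wk)"
  have c: "restr_vec T (snd wk + \<gamma> *\<^sub>R v) = \<gamma> *\<^sub>R ?c"
    using assms by (simp flip: restr_vec_scaleR add: scaleR_right_distrib add.commute)
  have "v + h + (1 / \<gamma>) *\<^sub>R snd wk = (v + (1 / \<gamma>) *\<^sub>R snd wk) + h" by simp
  then have "restr_vec T (v + h + (1 / \<gamma>) *\<^sub>R snd wk) = ?c + restr_vec T h"
    by (simp only: restr_vec_add)
  then have "(norm (restr_vec T (v + h + (1 / \<gamma>) *\<^sub>R snd wk)))\<^sup>2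
      = (norm ?c)\<^sup>2 + 2 * (?c \<bullet> h) + (norm (restr_vec T h))\<^sup>2"
    unfolding inner_restr_vec[of T _ h, symmetric]
    by (simp add: power2_norm_eq_inner inner_add_left inner_add_right inner_commute)
  then have eq: "h_k \<gamma> wk T (v + h) = h_k \<gamma> wk T v + restr_vec T (snd wk + \<gamma> *\<^sub>R v) \<bullet> h
      + \<gamma> / 2 * (norm (restr_vec T h))\<^sup>2"
    unfolding h_k_def c by (simp add: algebra_simps)
  have "0 \<le> \<gamma> / 2 * (norm (restr_vec T h))\<^sup>2" using assms by simp
  then show "h_k \<gamma> wk T v + restr_vec T (snd wk + \<gamma> *\<^sub>R v) \<bullet> h \<le> h_k \<gamma> wk T (v + h)" using eq by linarith
  have "\<gamma> / 2 * (norm (restr_vec T h))\<^sup>2 \<le> \<gamma> / 2 * (norm h)\<^sup>2"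
    using assms norm_restr_vec_le[of T h] by (intro mult_left_mono power_mono) auto
  then show "h_k \<gamma> wk T (v + h) \<le> h_k \<gamma> wk T v + restr_vec T (snd wk + \<gamma> *\<^sub>R v) \<bullet> h + \<gamma> / 2 * (norm h)\<^sup>2"
    using eq by linarith
qed

text \<open>The Fenchel-Young defect of h_k on the feasible set is an explicit square: nonnegative
  for every feasible z and zero at the recovered one. Feasibility lets inner products with z see
  only the coordinates in \<open>T\<close>.\<close>

lemma h_k_fenchel_young:
  assumes "\<gamma> > 0" "\<And>i. i \<notin> T \<Longrightarrow> z $ i = 0"
  shows "h_k \<gamma> wk T v + 1 / (2 * \<gamma>) * (norm (z - snd wk))\<^sup>2 - z \<bullet> v
     = 1 / (2 * \<gamma>) * (norm (restr_vec T (snd wk + \<gamma> *\<^sub>R v) - z))\<^sup>2"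
proof -
  define a where "a = restr_vec T (snd wk)"
  define c where "c = restr_vec T v"
  have z: "restr_vec T z = z" by (rule restr_vec_id) (rule assms(2))
  have zi: "z \<bullet> snd wk = z \<bullet> a" "z \<bullet> v = z \<bullet> c"
    using inner_restr_vec[of T z] by (simp_all add: z a_def c_def)
  have 1: "restr_vec T (snd wk + \<gamma> *\<^sub>R v) = a + \<gamma> *\<^sub>R c"
    "restr_vec T (v + (1 / \<gamma>) *\<^sub>R snd wk) = c + (1 / \<gamma>) *\<^sub>R a"
    by (simp_all add: restr_vec_add restr_vec_scaleR a_def c_def)
  have h: "h_k \<gamma> wk T v = \<gamma> / 2 * (c \<bullet> c) + c \<bullet> a + 1 / (2 * \<gamma>) * (a \<bullet> a) - 1 / (2 * \<gamma>) * (norm (snd wk))\<^sup>2"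
    unfolding h_k_def 1 using assms(1)
    by (simp add: power2_norm_eq_inner inner_add_left inner_add_right inner_commute field_simps)
  have q: "(norm (z - snd wk))\<^sup>2 = z \<bullet> z - 2 * (z \<bullet> a) + (norm (snd wk))\<^sup>2"
    unfolding zi(1)[symmetric] power2_norm_eq_inner by (simp add: inner_diff_left inner_diff_right inner_commute)
  have r: "(norm (a + \<gamma> *\<^sub>R c - z))\<^sup>2 = a \<bullet> a + \<gamma> * \<gamma> * (c \<bullet> c) + z \<bullet> z + 2 * \<gamma> * (c \<bullet> a) - 2 * (z \<bullet> a) - 2 * \<gamma> * (z \<bullet> c)"
    unfolding power2_norm_eq_inner by (simp add: algebra_simps inner_commute)
  show ?thesis unfolding 1 h q r zi using assms(1) by (simp add: field_simps)
qed

text \<open>The recovered y and z are the gradients of g_k at A x and of h_k at B x, so the chain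
  rule makes this the gradient of Psi_k. The same vector is the amount by which -Q^T w misses the
  gradient of f_k.\<close>

definition primal_grad where
  "primal_grad f g A B \<gamma> wk T x =
    shifted_grad \<gamma> f (adjoint (Qmap A B) wk) x + adjoint (Qmap A B) (dual_recovery g A B \<gamma> wk T x)"

lemma dual_recovery_eq:
  assumes "proper_closed_convex g" "\<gamma> > 0"
  shows "dual_recovery g A B \<gamma> wk T x =
    (shifted_grad \<gamma> g (- fst wk) (A *v x), restr_vec T (snd wk + \<gamma> *\<^sub>R (B *v x)))"
  using prox_fenchel_conj[OF assms, of "A *v x" "- fst wk"]
  by (simp add: dual_recovery_def restr_vec_def vec_eq_iff)

lemma dual_recovery_feasible: "i \<notin> T \<Longrightarrow> snd (dual_recovery g A B \<gamma> wk T x) $ i = 0"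
  by (simp add: dual_recovery_def)

lemma smooth_convex_Psi_k:
  assumes "proper_closed_convex f" "proper_closed_convex g" "\<gamma> > 0"
  obtains L where "0 < L" "smooth_convex L (Psi_k f g A B \<gamma> wk T) (primal_grad f g A B \<gamma> wk T)"
proof -
  obtain L1 where 1: "smooth_convex L1 (\<lambda>x. shifted_env \<gamma> g (- fst wk) (A *v x))
      (\<lambda>x. transpose A *v shifted_grad \<gamma> g (- fst wk) (A *v x))"
    by (rule smooth_convex_matrix[OF smooth_convex_shifted_env[OF assms(2,3)]])
  obtain L2 where 2: "smooth_convex L2 (\<lambda>x. h_k \<gamma> wk T (B *v x))
      (\<lambda>x. transpose B *v restr_vec T (snd wk + \<gamma> *\<^sub>R (B *v x)))"
    by (rule smooth_convex_matrix[OF smooth_convex_h_k[OF assms(3)]])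
  have "smooth_convex (\<gamma> + L1 + L2) (Psi_k f g A B \<gamma> wk T) (primal_grad f g A B \<gamma> wk T)"
    using smooth_convex_add[OF smooth_convex_add[OF smooth_convex_shifted_env[OF assms(1,3), of "adjoint (Qmap A B) wk"] 1] 2]
    by (simp add: Psi_k_def[abs_def] f_k_eq g_k_eq primal_grad_def[abs_def] dual_recovery_eq[OF assms(2,3)]
        adjoint_Qmap add.assoc del: transpose_matrix_vector)
  moreover have "0 < \<gamma> + L1 + L2"
    using assms(3) smooth_convexD(1)[OF 1] smooth_convexD(1)[OF 2] by simp
  ultimately show thesis using that by blast
qed

lemma gen_hessian_k_sym_psd_below:
  assumes "proper_closed_convex f" "proper_closed_convex g" "\<gamma> > 0"
  obtains L where "0 < L" "\<And>x H. H \<in> gen_hessian_k f g A B \<gamma> wk T x \<Longrightarrow> sym_psd_below L H"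
proof -
  obtain K1 where K1: "0 \<le> K1" "\<And>L V. 0 \<le> L \<Longrightarrow> sym_psd_below L V \<Longrightarrow> sym_psd_below (L * K1) (transpose A ** V ** A)"
    using sym_psd_below_congruence[of A] by blast
  obtain K2 where K2: "0 \<le> K2" "\<And>L V. 0 \<le> L \<Longrightarrow> sym_psd_below L V \<Longrightarrow>
      sym_psd_below (L * K2) (transpose (restr_rows T B) ** V ** restr_rows T B)"
    using sym_psd_below_congruence[of "restr_rows T B"] by blast
  let ?L = "\<gamma> + \<gamma> * K1 + \<gamma> * K2"
  have "sym_psd_below ?L H" if H: "H \<in> gen_hessian_k f g A B \<gamma> wk T x" for x H
  proof -
    obtain U V where UV: "H = U + transpose A ** V ** A + \<gamma> *\<^sub>R (transpose (restr_rows T B) ** restr_rows T B)"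
      "U \<in> clarke_jacobian (nabla (f_k f A B \<gamma> wk)) x"
      "V \<in> clarke_jacobian (nabla (g_k g \<gamma> wk)) (A *v x)"
      using H by (auto simp: gen_hessian_k_def)
    note sf = smooth_convex_shifted_env[OF assms(1,3), of "adjoint (Qmap A B) wk"]
    note sg = smooth_convex_shifted_env[OF assms(2,3), of "- fst wk"]
    have U: "sym_psd_below \<gamma> U"
      using UV(2) unfolding f_k_eq smooth_convex_nabla[OF sf] by (rule clarke_jacobian_sym_psd_below[OF sf])
    have V: "sym_psd_below \<gamma> V"
      using UV(3) unfolding g_k_eq smooth_convex_nabla[OF sg] by (rule clarke_jacobian_sym_psd_below[OF sg])
    have W: "sym_psd_below K2 (transpose (restr_rows T B) ** restr_rows T B)"
      using K2(2)[OF _ sym_psd_below_mat_1] by simp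
    show ?thesis unfolding UV(1)
      using assms(3) by (intro sym_psd_below_add sym_psd_below_scaleR U W K1(2) V) auto
  qed
  moreover have "0 < ?L" using assms(3) K1(1) K2(1) by (simp add: add_pos_nonneg)
  ultimately show thesis using that by blast
qed

text \<open>f_k outgrows every linear function. The slope \<open>norm G + 1\<close> absorbs the
  affine minorant of the g-term, taken at 0, and leaves slope one; h_k is bounded below by a
  constant.\<close>

lemma Psi_k_coercive:
  assumes "proper_closed_convex f" "proper_closed_convex g" "coercive f" "\<gamma> > 0"
  obtains C where "\<And>x. norm x - C \<le> Psi_k f g A B \<gamma> wk T x"
proof -
  note sg = smooth_convex_shifted_env[OF assms(2,4), of "- fst wk"]
  define G where "G = transpose A *v shifted_grad \<gamma> g (- fst wk) 0"
  obtain C where C: "\<And>x. (norm G + 1) * norm x - C \<le> shifted_env \<gamma> f (adjoint (Qmap A B) wk) x"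
    using shifted_env_coercive[OF assms(1,3,4), of "norm G + 1"] by auto
  define D where "D = C - shifted_env \<gamma> g (- fst wk) 0 + 1 / (2 * \<gamma>) * (norm (snd wk))\<^sup>2"
  have "norm x - D \<le> Psi_k f g A B \<gamma> wk T x" for x
  proof -
    have "shifted_env \<gamma> g (- fst wk) 0 + G \<bullet> x \<le> shifted_env \<gamma> g (- fst wk) (A *v x)"
      using smooth_convexD(2)[OF sg, of 0 "A *v x"] by (simp add: G_def inner_transpose_matrix del: transpose_matrix_vector)
    moreover have "\<bar>G \<bullet> x\<bar> \<le> norm G * norm x" by (rule Cauchy_Schwarz_ineq2)
    moreover have "(norm G + 1) * norm x = norm G * norm x + norm x" by (simp add: algebra_simps)
    moreover have "- (1 / (2 * \<gamma>) * (norm (snd wk))\<^sup>2) \<le> h_k \<gamma> wk T (B *v x)"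
      using assms(4) by (simp add: h_k_def)
    ultimately show ?thesis using C[of x] unfolding Psi_k_def f_k_eq g_k_eq D_def by linarith
  qed
  then show thesis using that by blast
qed

section \<open>Weak duality and the size of the gap\<close>

lemma Xi_k_weak_duality:
  assumes "proper_closed_convex f" "proper_closed_convex g" "\<gamma> > 0"
    and feas: "\<And>i. i \<notin> T \<Longrightarrow> snd w $ i = 0"
  shows "ereal (- Psi_k f g A B \<gamma> wk T x) \<le> Xi_k f g A B \<gamma> wk w"
proof -
  let ?Q = "adjoint (Qmap A B)"
  let ?a = "(- ?Q w) \<bullet> x - f_k f A B \<gamma> wk x - 1 / (2 * \<gamma>) * (norm (- ?Q w + ?Q wk))\<^sup>2"
  let ?b = "fst w \<bullet> (A *v x) - g_k g \<gamma> wk (A *v x) - 1 / (2 * \<gamma>) * (norm (fst w - fst wk))\<^sup>2"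
  let ?q = "1 / (2 * \<gamma>) * sqnorm_M A B (w - wk)"
  have a: "ereal ?a \<le> fenchel_conj f (- ?Q w)"
    unfolding f_k_eq by (rule shifted_env_fenchel_young(1)[OF assms(1,3)])
  have b: "ereal ?b \<le> fenchel_conj g (fst w)"
    using shifted_env_fenchel_young(1)[OF assms(2,3), of "fst w" "A *v x" "- fst wk"] by (simp add: g_k_eq)
  have "ereal (?a + ?b + ?q) \<le> Xi_k f g A B \<gamma> wk w"
    unfolding Xi_k_def Xi_def plus_ereal.simps(1)[symmetric] by (intro add_mono a b order_refl)
  \<comment> \<open>Each Fenchel-Young relation receives its square from \<open>sqnorm_M_eq\<close>,
    and the bilinear terms cancel by the definition of the adjoint.\<close>
  moreover have "- Psi_k f g A B \<gamma> wk T x \<le> ?a + ?b + ?q"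
  proof -
    have "0 \<le> 1 / (2 * \<gamma>) * (norm (restr_vec T (snd wk + \<gamma> *\<^sub>R (B *v x)) - snd w))\<^sup>2" using assms(3) by simp
    then have h: "snd w \<bullet> (B *v x) \<le> h_k \<gamma> wk T (B *v x) + 1 / (2 * \<gamma>) * (norm (snd w - snd wk))\<^sup>2"
      using h_k_fenchel_young[OF assms(3), of T "snd w" wk "B *v x"] feas by fastforce
    have n: "norm (- ?Q w + ?Q wk) = norm (?Q (w - wk))"
      by (simp add: adjoint_Qmap_diff norm_minus_commute)
    have "?q = 1 / (2 * \<gamma>) * (norm (?Q (w - wk)))\<^sup>2 + 1 / (2 * \<gamma>) * (norm (fst w - fst wk))\<^sup>2
        + 1 / (2 * \<gamma>) * (norm (snd w - snd wk))\<^sup>2"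
      by (simp add: sqnorm_M_eq power2_norm_prod distrib_left add_divide_distrib)
    moreover have "(- ?Q w) \<bullet> x = - (fst w \<bullet> (A *v x)) - snd w \<bullet> (B *v x)"
      by (simp add: adjoint_Qmap_inner)
    ultimately show ?thesis using h unfolding n Psi_k_def by linarith
  qed
  ultimately show ?thesis by (meson ereal_less_eq(3) order_trans)
qed

lemma gap_k_le_gradient:
  assumes "proper_closed_convex f" "proper_closed_convex g" "coercive f" "\<gamma> > 0"
  obtains C where "0 \<le> C"
    "\<And>x. norm x \<le> X \<Longrightarrow> norm (primal_grad f g A B \<gamma> wk T x) \<le> 1 \<Longrightarrow>
       gap_k f g A B \<gamma> wk T x (dual_recovery g A B \<gamma> wk T x) \<le> ereal (C * norm (primal_grad f g A B \<gamma> wk T x))"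
proof -
  let ?Q = "adjoint (Qmap A B)"
  define q where "q = ?Q wk"
  note sf = smooth_convex_shifted_env[OF assms(1,4), of q]
  define R where "R = norm (shifted_grad \<gamma> f q 0) + \<gamma> / 2 * (\<bar>X\<bar> + 1)\<^sup>2"
  have R: "norm (shifted_grad \<gamma> f q x) \<le> R" if "norm x \<le> X" for x
  proof -
    have "\<gamma> / 2 * (norm x + 1)\<^sup>2 \<le> \<gamma> / 2 * (\<bar>X\<bar> + 1)\<^sup>2"
      using that assms(4) by (intro mult_left_mono power_mono) auto
    then show ?thesis using smooth_convex_gradient_growth[OF sf, of x] unfolding R_def by linarith
  qed
  obtain K where K: "0 \<le> K" "\<And>s e a. norm s \<le> R \<Longrightarrow> norm e \<le> 1 \<Longrightarrow> fenchel_conj f s = ereal a \<Longrightarrow>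
    fenchel_conj f (s - e) \<le> ereal (a + K * norm e)"
    using fenchel_conj_locally_lipschitz[OF assms(1,3), of R] by blast
  \<comment> \<open>\<open>K\<close> pays for moving the argument of the conjugate of f by
    \<open>G\<close>, \<open>\<bar>X\<bar>\<close> for \<open>G \<bullet> x\<close>, and the last
    summand for the change of the square, where a gradient norm of at most 1 dominates its own
    square.\<close>
  define C where "C = K + \<bar>X\<bar> + 1 / (2 * \<gamma>) * (1 + 2 * (\<bar>R\<bar> + norm q))"
  have "0 \<le> C" using K(1) assms(4) by (simp add: C_def)
  moreover have "gap_k f g A B \<gamma> wk T x (dual_recovery g A B \<gamma> wk T x)
      \<le> ereal (C * norm (primal_grad f g A B \<gamma> wk T x))"
    if x: "norm x \<le> X" and G1: "norm (primal_grad f g A B \<gamma> wk T x) \<le> 1" for x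
  proof -
    define G where "G = primal_grad f g A B \<gamma> wk T x"
    define s where "s = shifted_grad \<gamma> f q x"
    define w where "w = dual_recovery g A B \<gamma> wk T x"
    have G: "G = s + ?Q w" by (simp add: G_def primal_grad_def s_def q_def w_def)
    have y: "fst w = shifted_grad \<gamma> g (- fst wk) (A *v x)"
      and z: "snd w = restr_vec T (snd wk + \<gamma> *\<^sub>R (B *v x))"
      by (simp_all add: w_def dual_recovery_eq[OF assms(2,4)])
    let ?a = "s \<bullet> x - f_k f A B \<gamma> wk x - 1 / (2 * \<gamma>) * (norm (s + q))\<^sup>2"
    let ?b = "fst w \<bullet> (A *v x) - g_k g \<gamma> wk (A *v x) - 1 / (2 * \<gamma>) * (norm (fst w - fst wk))\<^sup>2"
    let ?q = "1 / (2 * \<gamma>) * sqnorm_M A B (w - wk)"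
    have "fenchel_conj f s = ereal ?a"
      unfolding f_k_eq q_def[symmetric] s_def by (rule shifted_env_fenchel_young(2)[OF assms(1,4)])
    then have "fenchel_conj f (s - G) \<le> ereal (?a + K * norm G)"
      using R[OF x] G1 by (intro K(2)) (simp_all add: s_def G_def)
    moreover have "s - G = - ?Q w" by (simp add: G)
    ultimately have a: "fenchel_conj f (- ?Q w) \<le> ereal (?a + K * norm G)" by simp
    have b: "fenchel_conj g (fst w) \<le> ereal ?b"
      using shifted_env_fenchel_young(2)[OF assms(2,4), of "- fst wk" "A *v x"]
      unfolding y g_k_eq by simp
    have "Xi_k f g A B \<gamma> wk w \<le> ereal ((?a + K * norm G) + ?b + ?q)"
      unfolding Xi_k_def Xi_def plus_ereal.simps(1)[symmetric, of "_ + _"] plus_ereal.simps(1)[symmetric, of "_ + _" "_ - _"]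
      by (intro add_mono a b order_refl)
    then have "gap_k f g A B \<gamma> wk T x w \<le> ereal (Psi_k f g A B \<gamma> wk T x + ((?a + K * norm G) + ?b + ?q))"
      unfolding gap_k_def plus_ereal.simps(1)[symmetric, of "Psi_k f g A B \<gamma> wk T x"] by (rule add_left_mono)
    also have "\<dots> \<le> ereal (C * norm G)"
    proof -
      have h: "h_k \<gamma> wk T (B *v x) + 1 / (2 * \<gamma>) * (norm (snd w - snd wk))\<^sup>2 = snd w \<bullet> (B *v x)"
        using h_k_fenchel_young[OF assms(4), where z = "snd w" and T = T and v = "B *v x" and wk = wk]
        unfolding z by (simp add: restr_vec_def)
      have Qw: "?Q (w - wk) = G - (s + q)" by (simp add: adjoint_Qmap_diff G q_def)
      have "?q = 1 / (2 * \<gamma>) * (norm (G - (s + q)))\<^sup>2 + 1 / (2 * \<gamma>) * (norm (fst w - fst wk))\<^sup>2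
          + 1 / (2 * \<gamma>) * (norm (snd w - snd wk))\<^sup>2"
        by (simp add: sqnorm_M_eq power2_norm_prod distrib_left add_divide_distrib Qw)
      moreover have "fst w \<bullet> (A *v x) + snd w \<bullet> (B *v x) = G \<bullet> x - s \<bullet> x"
        unfolding adjoint_Qmap_inner[symmetric] G by (simp add: inner_add_left)
      moreover have "1 / (2 * \<gamma>) * (norm (G - (s + q)))\<^sup>2 = 1 / (2 * \<gamma>) * (norm (s + q))\<^sup>2
          + 1 / (2 * \<gamma>) * ((norm G)\<^sup>2 - 2 * (G \<bullet> (s + q)))"
      proof -
        have "(norm (G - (s + q)))\<^sup>2 = (norm (s + q))\<^sup>2 + ((norm G)\<^sup>2 - 2 * (G \<bullet> (s + q)))"
          unfolding power2_norm_eq_inner by (simp add: inner_diff_left inner_diff_right inner_commute)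
        then show ?thesis by (simp add: distrib_left add_divide_distrib)
      qed
      \<comment> \<open>The three Fenchel-Young equalities cancel against Psi_k; every term that
        remains carries a factor \<open>G\<close>.\<close>
      ultimately have eq: "Psi_k f g A B \<gamma> wk T x + ((?a + K * norm G) + ?b + ?q)
          = K * norm G + G \<bullet> x + 1 / (2 * \<gamma>) * ((norm G)\<^sup>2 - 2 * (G \<bullet> (s + q)))"
        using h unfolding Psi_k_def by linarith
      have "G \<bullet> x \<le> norm G * norm x" by (rule norm_cauchy_schwarz)
      also have "\<dots> \<le> norm G * \<bar>X\<bar>" using x by (intro mult_left_mono) auto
      finally have 1: "G \<bullet> x \<le> norm G * \<bar>X\<bar>" .
      have "norm (s + q) \<le> \<bar>R\<bar> + norm q" using norm_triangle_ineq[of s q] R[OF x] by (simp add: s_def)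
      then have "norm G * norm (s + q) \<le> norm G * (\<bar>R\<bar> + norm q)" by (intro mult_left_mono) auto
      moreover have "\<bar>G \<bullet> (s + q)\<bar> \<le> norm G * norm (s + q)" by (rule Cauchy_Schwarz_ineq2)
      moreover have "(norm G)\<^sup>2 \<le> norm G"
        using G1 by (simp add: G_def power2_eq_square mult_left_le)
      ultimately have "(norm G)\<^sup>2 - 2 * (G \<bullet> (s + q)) \<le> norm G * (1 + 2 * (\<bar>R\<bar> + norm q))"
        by (simp add: algebra_simps)
      then have "1 / (2 * \<gamma>) * ((norm G)\<^sup>2 - 2 * (G \<bullet> (s + q))) \<le> 1 / (2 * \<gamma>) * (norm G * (1 + 2 * (\<bar>R\<bar> + norm q)))"
        using assms(4) by (intro mult_left_mono) auto
      then show ?thesis unfolding eq C_def using 1 by (simp add: algebra_simps)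
    qed
    finally show ?thesis by (simp add: w_def G_def)
  qed
  ultimately show thesis using that by blast
qed

section \<open>Distance of feasible dual points from w^k\<close>

lemma ereal_less_add_split:
  fixes F G :: ereal
  assumes "ereal c < F + G" "F \<noteq> -\<infinity>" "G \<noteq> -\<infinity>"
  obtains a b where "ereal a < F" "ereal b < G" "c < a + b"
proof (cases F)
  case F: (real u)
  show ?thesis
  proof (cases G)
    case (real v)
    have "c < u + v" using assms(1) F real by simp
    then show thesis
      using that[of "u - (u + v - c) / 4" "v - (u + v - c) / 4"] F real by (simp add: field_simps)
  next
    case PInf
    then show thesis using that[of "u - 1" "c - u + 2"] F by simp
  qed (use assms in simp)
next
  case F: PInf
  show ?thesis
  proof (cases G)
    case (real v)
    then show thesis using that[of "c - v + 2" "v - 1"] F by simp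
  next
    case PInf
    then show thesis using that[of "c + 1" 0] F by simp
  qed (use assms in simp)
qed (use assms in simp)

lemma fenchel_conj_not_MInf:
  assumes "proper_closed_convex \<psi>"
  shows "fenchel_conj \<psi> s \<noteq> -\<infinity>"
proof -
  obtain x0 where "\<psi> x0 \<noteq> \<infinity>" "\<psi> x0 \<noteq> -\<infinity>" using assms by (auto simp: proper_closed_convex_def)
  then obtain r0 where "\<psi> x0 = ereal r0" by (cases "\<psi> x0") auto
  then show ?thesis using fenchel_conj_ge[of \<psi> x0 r0 s] by auto
qed

lemma fenchel_conj_approx:
  assumes "proper_closed_convex \<psi>" "ereal a < fenchel_conj \<psi> s"
  obtains u r where "\<psi> u = ereal r" "a < s \<bullet> u - r"
proof -
  obtain u where u: "ereal a < ereal (s \<bullet> u) - \<psi> u"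
    using assms(2) unfolding fenchel_conj_def less_SUP_iff by blast
  have "\<psi> u \<noteq> -\<infinity>" using assms(1) by (simp add: proper_closed_convex_def)
  then obtain r where "\<psi> u = ereal r" using u by (cases "\<psi> u") auto
  then show thesis using that u by simp
qed

text \<open>If \<open>wk\<close> is infeasible, a nonzero coordinate outside \<open>T\<close> separates it from \<open>w\<close>; otherwise
  a continuous minorant of the dual objective exceeds the value of a better point near \<open>wk\<close>.\<close>

lemma dual_distance_bound:
  fixes A :: "real^'n^'m" and B :: "real^'n^'p"
  assumes "proper_closed_convex f" "proper_closed_convex g" "\<gamma> > 0"
    and not_sol: "\<not> solves_D_k f g A B \<gamma> wk T wk"
  obtains \<delta> e where "0 < \<delta>" "0 < e"
    "\<And>x w. (\<And>i. i \<notin> T \<Longrightarrow> snd w $ i = 0) \<Longrightarrow> gap_k f g A B \<gamma> wk T x w \<le> ereal e \<Longrightarrow> \<delta> \<le> (norm (w - wk))\<^sup>2"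
proof (cases "\<forall>i. i \<notin> T \<longrightarrow> snd wk $ i = 0")
  case False
  then obtain i where i: "i \<notin> T" "snd wk $ i \<noteq> 0" by blast
  have "(snd wk $ i)\<^sup>2 \<le> (norm (w - wk))\<^sup>2" if w: "\<And>i. i \<notin> T \<Longrightarrow> snd w $ i = 0" for w :: "('m, 'p) dual"
  proof -
    have "\<bar>snd wk $ i\<bar> = \<bar>(snd w - snd wk) $ i\<bar>" using w[OF i(1)] by simp
    also have "\<dots> \<le> norm (snd w - snd wk)" by (rule component_le_norm_cart)
    also have "\<dots> \<le> norm (w - wk)" by (metis norm_snd_le prod.collapse snd_diff)
    finally show ?thesis by (metis abs_ge_zero power2_abs power_mono)
  qed
  then show thesis using that[of "(snd wk $ i)\<^sup>2" 1] i(2) by simp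
next
  case True
  then obtain w' where w': "\<And>i. i \<notin> T \<Longrightarrow> snd w' $ i = 0" "Xi_k f g A B \<gamma> wk w' < Xi_k f g A B \<gamma> wk wk"
    using not_sol unfolding solves_D_k_def is_arg_min_def by blast
  let ?Q = "adjoint (Qmap A B)"
  have wk: "Xi_k f g A B \<gamma> wk wk = fenchel_conj f (- ?Q wk) + fenchel_conj g (fst wk)"
    by (simp add: Xi_k_def Xi_def sqnorm_M_def)
  have "ereal (- Psi_k f g A B \<gamma> wk T 0) \<le> Xi_k f g A B \<gamma> wk w'"
    by (rule Xi_k_weak_duality[OF assms(1-3) w'(1)])
  then obtain a where a: "Xi_k f g A B \<gamma> wk w' = ereal a"
    using w'(2) by (cases "Xi_k f g A B \<gamma> wk w'") auto
  \<comment> \<open>The level \<open>b\<close> separates the value \<open>a\<close> of the better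
    point from the value at \<open>wk\<close>, which may be infinite; the distance between the
    levels becomes the admissible gap \<open>e\<close>.\<close>
  obtain b where b: "ereal a < ereal b" "ereal b < Xi_k f g A B \<gamma> wk wk"
    using w'(2) unfolding a by (metis ereal_dense2)
  define e where "e = b - a"
  have e: "0 < e" "b = a + e" using b(1) by (simp_all add: e_def)
  obtain c1 c2 where c: "ereal c1 < fenchel_conj f (- ?Q wk)" "ereal c2 < fenchel_conj g (fst wk)" "b < c1 + c2"
    using b(2) unfolding wk
    by (rule ereal_less_add_split) (use fenchel_conj_not_MInf assms in blast)+
  obtain u r where u: "f u = ereal r" "c1 < (- ?Q wk) \<bullet> u - r" by (rule fenchel_conj_approx[OF assms(1) c(1)])
  obtain v r' where v: "g v = ereal r'" "c2 < fst wk \<bullet> v - r'" by (rule fenchel_conj_approx[OF assms(2) c(2)])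
  \<comment> \<open>Points nearly attaining the two conjugates at \<open>wk\<close> give an affine
    minorant of Xi that exceeds \<open>b\<close> there. It serves as lower semicontinuity and covers
    an infinite value at \<open>wk\<close>.\<close>
  define l where "l = (\<lambda>w::('m, 'p) dual. (- (fst w \<bullet> (A *v u)) - snd w \<bullet> (B *v u) - r) + (fst w \<bullet> v - r'))"
  have l: "l w = ((- ?Q w) \<bullet> u - r) + (fst w \<bullet> v - r')" for w
    by (simp add: l_def adjoint_Qmap_inner)
  have lwk: "b < l wk" unfolding l using u(2) v(2) c(3) by linarith
  have "isCont l wk" unfolding l_def by (intro continuous_intros)
  then have "\<forall>\<^sub>F w in at wk. b < l w" using lwk by (intro order_tendstoD(1)) (auto simp: isCont_def)
  then obtain d where d: "0 < d" "\<And>w. w \<noteq> wk \<Longrightarrow> dist w wk < d \<Longrightarrow> b < l w"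
    unfolding eventually_at by blast
  have "d\<^sup>2 \<le> (norm (w - wk))\<^sup>2"
    if w: "\<And>i. i \<notin> T \<Longrightarrow> snd w $ i = 0" and gap: "gap_k f g A B \<gamma> wk T x w \<le> ereal e" for x w
  proof (rule ccontr)
    assume "\<not> ?thesis"
    then have "norm (w - wk) < d" using d(1) by (meson less_imp_le linorder_not_le power_mono)
    then have "b < l w" using d(2)[of w] lwk by (cases "w = wk") (auto simp: dist_norm)
    also have "ereal (l w) \<le> Xi f g A B w"
      unfolding l Xi_def plus_ereal.simps(1)[symmetric]
      by (intro add_mono fenchel_conj_ge u(1) v(1))
    also have "\<dots> \<le> Xi_k f g A B \<gamma> wk w"
      using assms(3) by (auto simp: Xi_k_def sqnorm_M_eq intro!: ereal_le_add_self)
    finally have "ereal b < Xi_k f g A B \<gamma> wk w" by simp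
    \<comment> \<open>Weak duality at the better point gives Psi_k(x) \<ge> - a, so a dual value
      above \<open>b\<close> forces the gap above \<open>b - a = e\<close>.\<close>
    moreover have "ereal (- Psi_k f g A B \<gamma> wk T x) \<le> ereal a"
      unfolding a[symmetric] by (rule Xi_k_weak_duality[OF assms(1-3) w'(1)])
    ultimately show False
      using gap e by (cases "Xi_k f g A B \<gamma> wk w") (auto simp: gap_k_def)
  qed
  then show thesis using that[of "d\<^sup>2" e] d(1) e(1) by simp
qed

section \<open>Convergence of the Newton iterates and the stopping criteria\<close>

lemma SNA_gradient_tendsto_zero:
  assumes "proper_closed_convex f" "proper_closed_convex g" "coercive f" "\<gamma> > 0"
    and par: "0 < \<tau>" "0 < \<tau>1" "0 < \<tau>2" "\<tau>2 < 1" "0 < \<beta>" "\<beta> < 1" "0 < \<zeta>" "\<zeta> < 1"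
    and SNA: "SNA_sequence f g A B \<gamma> wk T \<tau> \<tau>1 \<tau>2 \<beta> \<zeta> xk xb wb"
  shows "(\<lambda>j. primal_grad f g A B \<gamma> wk T (xb j)) \<longlonglongrightarrow> 0" "bounded (range xb)"
proof -
  let ?\<Psi> = "Psi_k f g A B \<gamma> wk T" and ?G = "primal_grad f g A B \<gamma> wk T"
  obtain L where L: "0 < L" "smooth_convex L ?\<Psi> ?G" using smooth_convex_Psi_k[OF assms(1,2,4)] by blast
  note nabla = smooth_convex_nabla[OF L(2)]
  obtain K where K: "0 < K" "\<And>x H. H \<in> gen_hessian_k f g A B \<gamma> wk T x \<Longrightarrow> sym_psd_below K H"
    using gen_hessian_k_sym_psd_below[OF assms(1,2,4)] by blast
  obtain C where C: "\<And>x. norm x - C \<le> ?\<Psi> x" using Psi_k_coercive[OF assms(1-4)] by blast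
  have "\<exists>d \<alpha>. \<forall>j. newton_direction \<tau> \<tau>1 \<tau>2 ?\<Psi> (gen_hessian_k f g A B \<gamma> wk T) (xb j) (d j) \<and>
        line_search_step \<beta> \<zeta> ?\<Psi> (xb j) (d j) (\<alpha> j) \<and> xb (Suc j) = xb j + \<alpha> j *\<^sub>R d j"
    using SNA unfolding SNA_sequence_def by metis
  then obtain d \<alpha> where nd: "\<And>j. newton_direction \<tau> \<tau>1 \<tau>2 ?\<Psi> (gen_hessian_k f g A B \<gamma> wk T) (xb j) (d j)"
    and ls: "\<And>j. line_search_step \<beta> \<zeta> ?\<Psi> (xb j) (d j) (\<alpha> j)"
    and step: "\<And>j. xb (Suc j) = xb j + \<alpha> j *\<^sub>R d j" by blast
  note bounds = newton_direction_bounds[OF nd K(2) less_imp_le[OF K(1)] par(1-4), unfolded nabla]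
  \<comment> \<open>Here the gradient bound is the norm at the current iterate itself. A bound
    uniform in j requires bounded iterates, and these rest on the descent proved here.\<close>
  have desc: "0 \<le> - (?G (xb j) \<bullet> d j)" for j
  proof -
    have "0 \<le> (K + \<tau>1 * norm (?G (xb j))) * - (?G (xb j) \<bullet> d j)"
      by (rule order_trans[OF zero_le_power2 bounds(1)[OF _ order_refl]])
    moreover have "0 < K + \<tau>1 * norm (?G (xb j))" using K(1) par(2) by (simp add: add_pos_nonneg)
    ultimately show ?thesis by (simp only: zero_le_mult_iff) auto
  qed
  have "?\<Psi> (xb j) \<le> ?\<Psi> (xb 0)" for j
  proof (induction j)
    case (Suc j)
    have "0 \<le> \<zeta> * \<alpha> j * - (?G (xb j) \<bullet> d j)"
      using par(7) line_search_decrease(1)[OF L(2) par(5) ls] by (intro mult_nonneg_nonneg desc) (auto intro: less_imp_le)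
    then show ?case using line_search_decrease(2)[OF L(2) par(5) ls, of j] Suc by (simp add: step)
  qed simp
  then have X: "norm (xb j) \<le> ?\<Psi> (xb 0) + C" for j using C[of "xb j"] by (smt (verit))
  then show "bounded (range xb)" unfolding bounded_iff by blast
  define N where "N = norm (?G 0) + L / 2 * (\<bar>?\<Psi> (xb 0) + C\<bar> + 1)\<^sup>2"
  have N: "norm (?G (xb j)) \<le> N" for j
  proof -
    have "L / 2 * (norm (xb j) + 1)\<^sup>2 \<le> L / 2 * (\<bar>?\<Psi> (xb 0) + C\<bar> + 1)\<^sup>2"
      using X[of j] L(1) by (intro mult_left_mono power_mono) auto
    then show ?thesis using smooth_convex_gradient_growth[OF L(2), of "xb j"] unfolding N_def by linarith
  qed
  show "(\<lambda>j. ?G (xb j)) \<longlonglongrightarrow> 0"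
  proof (rule armijo_gradient_tendsto_zero[where x = xb and d = d and \<alpha> = \<alpha>, OF L(2,1) par(5-8) ls step])
    show "- C \<le> ?\<Psi> y" for y using C[of y] norm_ge_zero[of y] by linarith
    show "norm (d j) \<le> (1 + N powr \<tau>) / \<tau>1" for j by (rule bounds(2)[OF _ N])
    show "0 < (1 + N powr \<tau>) / \<tau>1" using par(2) by (simp add: add_pos_nonneg)
    show "(norm (?G (xb j)))\<^sup>2 \<le> (K + \<tau>1 * N) * - (?G (xb j) \<bullet> d j)" for j by (rule bounds(1)[OF _ N])
    show "0 < K + \<tau>1 * N" using K(1) par(2) order_trans[OF norm_ge_zero N] by (simp add: add_pos_nonneg)
  qed
qed

text \<open>Zero tolerances would demand a zero gap, which the iterates may reach only in the limit.
  If w^k solved (D_k), the distance of the recovered points from it, and with it the right-hand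
  sides of (C1) and (C3), would have no positive lower bound to compare with the gap.\<close>

theorem theorem6:
  fixes f :: "real^'n \<Rightarrow> ereal" and g :: "real^'m \<Rightarrow> ereal"
    and A :: "real^'n^'m" and B :: "real^'n^'p::{finite,linorder}"
    and \<mu> :: "real^'p::{finite,linorder}" and k :: nat and \<gamma>k :: real
    and xk :: "real^'n" and wk :: "('m, 'p) dual" and zt :: "real^'p::{finite,linorder}"
    and \<epsilon> \<eta> :: "nat \<Rightarrow> real" and \<tau> \<tau>1 \<tau>2 \<beta> \<zeta> :: real
    and xb :: "nat \<Rightarrow> real^'n" and wb :: "nat \<Rightarrow> ('m, 'p) dual"
  assumes "proper_closed_convex f" and "proper_closed_convex g" and "coercive f"
    and "\<forall>i. \<mu> $ i > 0" and "\<gamma>k > 0"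
    and "coord_cycle f g A B \<gamma>k \<mu> wk zt"
    and "\<forall>i. 0 \<le> \<epsilon> i" and "summable \<epsilon>"
    and "\<forall>i. 0 \<le> \<eta> i \<and> \<eta> i < 1" and "summable \<eta>"
    and "0 < \<tau>" "\<tau> \<le> 1" and "0 < \<tau>1" "\<tau>1 < 1" and "0 < \<tau>2" "\<tau>2 < 1"
    and "0 < \<beta>" "\<beta> < 1" and "0 < \<zeta>" "\<zeta> < 1 / 2"
    and "SNA_sequence f g A B \<gamma>k wk (supp zt) \<tau> \<tau>1 \<tau>2 \<beta> \<zeta> xk xb wb"
    and "0 < \<epsilon> k" and "0 < \<eta> k" and "\<not> solves_D_k f g A B \<gamma>k wk (supp zt) wk"
  shows "\<forall>\<^sub>F j in sequentially.
           Xi_k f g A B \<gamma>k wk (wb j) - Xi_k f g A B \<gamma>k wk (fst wk, zt)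
             \<le> ereal (1 / (4 * \<gamma>k) * sqnorm_M A B (wb j - wk)) \<and>
           gap_k f g A B \<gamma>k wk (supp zt) (xb j) (wb j) \<le> ereal ((\<epsilon> k)\<^sup>2 / (2 * \<gamma>k)) \<and>
           gap_k f g A B \<gamma>k wk (supp zt) (xb j) (wb j)
             \<le> ereal ((\<eta> k)\<^sup>2 / (2 * \<gamma>k) * sqnorm_M A B (wb j - wk))"
proof -
  let ?T = "supp zt"
  let ?gap = "\<lambda>j. gap_k f g A B \<gamma>k wk ?T (xb j) (wb j)"
  let ?G = "primal_grad f g A B \<gamma>k wk ?T"
  note pcc = assms(1,2) and \<gamma> = \<open>\<gamma>k > 0\<close>
  have wb: "wb j = dual_recovery g A B \<gamma>k wk ?T (xb j)" for j
    using assms(21) unfolding SNA_sequence_def by blast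
  have \<zeta>: "\<zeta> < 1" using assms(20) by simp
  have lim: "(\<lambda>j. ?G (xb j)) \<longlonglongrightarrow> 0" and "bounded (range xb)"
    using SNA_gradient_tendsto_zero[OF pcc assms(3,5,11,13,15-19) \<zeta> assms(21)] by blast+
  then obtain X where X: "\<And>j. norm (xb j) \<le> X" unfolding bounded_iff by blast
  obtain C where C: "0 \<le> C" "\<And>x. norm x \<le> X \<Longrightarrow> norm (?G x) \<le> 1 \<Longrightarrow>
       gap_k f g A B \<gamma>k wk ?T x (dual_recovery g A B \<gamma>k wk ?T x) \<le> ereal (C * norm (?G x))"
    using gap_k_le_gradient[OF pcc assms(3,5)] by blast
  have gap_small: "\<forall>\<^sub>F j in sequentially. ?gap j \<le> ereal e" if "0 < e" for e
  proof -
    have "(\<lambda>j. norm (?G (xb j))) \<longlonglongrightarrow> 0" using lim by (simp only: tendsto_norm_zero_iff)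
    \<comment> \<open>The bound 1 is the range of the gap estimate; the divisor \<open>C + 1\<close>
      is positive even for \<open>C = 0\<close>.\<close>
    moreover have "0 < min 1 (e / (C + 1))" using that C(1) by simp
    ultimately have "\<forall>\<^sub>F j in sequentially. norm (?G (xb j)) < min 1 (e / (C + 1))"
      by (rule order_tendstoD(2))
    then show ?thesis
    proof eventually_elim
      case (elim j)
      have "C * norm (?G (xb j)) \<le> (C + 1) * norm (?G (xb j))" by (simp add: distrib_right)
      also have "\<dots> \<le> e" using elim C(1) by (simp add: field_simps)
      finally have "C * norm (?G (xb j)) \<le> e" .
      moreover have "?gap j \<le> ereal (C * norm (?G (xb j)))"
        unfolding wb using C(2)[OF X] elim by simp
      ultimately show ?case by (meson ereal_less_eq(3) order_trans)
    qed
  qed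
  obtain \<delta> e where \<delta>: "0 < \<delta>" "0 < e"
    "\<And>x w. (\<And>i. i \<notin> ?T \<Longrightarrow> snd w $ i = 0) \<Longrightarrow> gap_k f g A B \<gamma>k wk ?T x w \<le> ereal e \<Longrightarrow> \<delta> \<le> (norm (w - wk))\<^sup>2"
    using dual_distance_bound[OF pcc \<gamma> assms(24)] by blast
  \<comment> \<open>The first threshold triggers the lower bound \<delta>; the others are the
    right-hand sides of (C1), (C2) and (C3), with \<delta> in place of the squared M-norm.\<close>
  define e' where "e' = min (min e (1 / (4 * \<gamma>k) * \<delta>)) (min ((\<epsilon> k)\<^sup>2 / (2 * \<gamma>k)) ((\<eta> k)\<^sup>2 / (2 * \<gamma>k) * \<delta>))"
  have "0 < e'" using \<delta>(1,2) \<gamma> assms(22,23) by (simp add: e'_def)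
  from gap_small[OF this] show ?thesis
  proof eventually_elim
    case (elim j)
    then have le: "?gap j \<le> ereal e" "?gap j \<le> ereal (1 / (4 * \<gamma>k) * \<delta>)"
      "?gap j \<le> ereal ((\<epsilon> k)\<^sup>2 / (2 * \<gamma>k))" "?gap j \<le> ereal ((\<eta> k)\<^sup>2 / (2 * \<gamma>k) * \<delta>)"
      by (auto simp: e'_def min_def split: if_splits intro: order_trans)
    have "\<delta> \<le> (norm (wb j - wk))\<^sup>2"
      by (rule \<delta>(3)[OF _ le(1)]) (simp add: wb dual_recovery_feasible)
    then have M: "\<delta> \<le> sqnorm_M A B (wb j - wk)" unfolding sqnorm_M_eq by (simp add: add_increasing)
    have M1: "1 / (4 * \<gamma>k) * \<delta> \<le> 1 / (4 * \<gamma>k) * sqnorm_M A B (wb j - wk)"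
      by (rule mult_left_mono[OF M]) (use \<gamma> in simp)
    have M2: "(\<eta> k)\<^sup>2 / (2 * \<gamma>k) * \<delta> \<le> (\<eta> k)\<^sup>2 / (2 * \<gamma>k) * sqnorm_M A B (wb j - wk)"
      by (rule mult_left_mono[OF M]) (use \<gamma> in simp)
    \<comment> \<open>The starting dual point is feasible because \<open>T\<close> is the support of
      \<open>zt\<close>. Its dual value is therefore at least - Psi_k at the iterate, so the gap
      dominates the difference in (C1).\<close>
    have wd: "ereal (- Psi_k f g A B \<gamma>k wk ?T (xb j)) \<le> Xi_k f g A B \<gamma>k wk (fst wk, zt)"
      by (rule Xi_k_weak_duality[OF pcc \<gamma>]) (simp add: supp_def)
    have "Xi_k f g A B \<gamma>k wk (wb j) - Xi_k f g A B \<gamma>k wk (fst wk, zt) \<le> ?gap j"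
      using wd by (cases "Xi_k f g A B \<gamma>k wk (wb j)"; cases "Xi_k f g A B \<gamma>k wk (fst wk, zt)")
        (auto simp: gap_k_def)
    then have "Xi_k f g A B \<gamma>k wk (wb j) - Xi_k f g A B \<gamma>k wk (fst wk, zt)
        \<le> ereal (1 / (4 * \<gamma>k) * sqnorm_M A B (wb j - wk))"
      using le(2) M1 by (meson ereal_less_eq(3) order_trans)
    moreover have "?gap j \<le> ereal ((\<eta> k)\<^sup>2 / (2 * \<gamma>k) * sqnorm_M A B (wb j - wk))"
      using le(4) M2 by (meson ereal_less_eq(3) order_trans)
    ultimately show ?case using le(3) by blast
  qed
qed

end
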